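(* Let $\alpha$ be as in the context, and consider the indices of the factors of length $n>0$ in $\mathcal{L}(\alpha)$; let $k\ge2$. (i) If $n<q_1$, then every conjugate of $0^{n-1}1$ has index $1$, and the remaining factor $0^n$ has index $\lfloor a_1/n\rfloor$. (ii) If $n=q_1$, then every conjugate of $\widetilde{s}_1$ has index $a_2+1$, and the remaining factor $0^{a_1}$ has index $1$. (iii) If $n=q_k$, then $C^i(\widetilde{s}_k)$ has index $a_{k+1}+2$ for $0\le i\le q_{k-1}-2$, $C^i(\widetilde{s}_k)$ has index $a_{k+1}+1$ for $q_{k-1}-1\le i\le n-1$, and the remaining factor of length $n$ has index $1$. (iv) If $n=q_{k,l}$ with $0<l<a_k$, then $C^i(\widetilde{s}_{k,l})$ has index $2$ for $0\le i\le q_{k-1}-2$, and all remaining factors of length $n$ have index $1$. (v) If $n=mq_1$ with $1<m<a_2+1$, then $C^i(\widetilde{s}_1^{\,m})$ has index $\lfloor (a_2+1)/m\rfloor$ for $0\le i\le q_1-1$, and every remaining factor of length $n$ has index $1$. (vi) If $n=mq_k$ with $1<m<a_{k+1}+2$, then $C^i(\widetilde{s}_k^{\,m})$ has index $\lfloor (a_{k+1}+2)/m\rfloor$ for $0\le i\le q_{k-1}-2$, $C^i(\widetilde{s}_k^{\,m})$ has index $\lfloor (a_{k+1}+1)/m\rfloor$ for $q_{k-1}-1\le i\le q_k-1$, and every remaining factor of length $n$ has index $1$. (vii) If $n$ does not fall into any of the cases (i)–(vi), then every factor of length $n$ in $\mathcal{L}(\alpha)$ has index $1$.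
   Context: Let $\alpha\in(0,1)$ be irrational with $\alpha=[0;a_1,a_2,\ldots]$ ($a_i$ positive integers) and $a_1\ge2$. Define $q_0=1$, $q_1=a_1$, $q_k=a_kq_{k-1}+q_{k-2}$ ($k\ge2$), and $q_{k,l}=lq_{k-1}+q_{k-2}$ for $k\ge2$, $0\le l\le a_k$. Standard words: $s_{-1}=1$, $s_0=0$, $s_1=0^{a_1-1}1$, $s_k=s_{k-1}^{a_k}s_{k-2}$ ($k\ge2$); semistandard words $s_{k,l}=s_{k-1}^ls_{k-2}$ for $k\ge2$, $0<l<a_k$. For a word $w=b_1\cdots b_n$, $\widetilde{w}=b_n\cdots b_1$ is its reversal, $C(b_1\cdots b_{n-1}b_n)=b_nb_1\cdots b_{n-1}$ the cyclic shift, and the conjugates of $w$ are the words $C^i(w)$, $0\le i<|w|$. Let $R(x)=\{x+\alpha\}$ on $[0,1)$, $I_0=[0,1-\alpha)$, $I_1=[1-\alpha,1)$, and $s_{x,\alpha}$ the infinite word whose $n$-th letter ($n\ge0$) is $0$ if $R^n(x)\in I_0$ and $1$ otherwise. $\mathcal{L}(\alpha)$ is the set of finite factors of $s_{x,\alpha}$ (independent of $x$). The index of a nonempty $w\in\mathcal{L}(\alpha)$ is $\sup\{p\in\mathbb{Z}_{\ge1}: w^p\in\mathcal{L}(\alpha)\}$ (always finite). *)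

theory Defs
  imports Complex_Main "HOL-Library.Extended_Nat"
begin

text \<open>
  Words over the alphabet \<open>{0, 1}\<close> are lists of naturals; infinite words are functions on
  \<^typ>\<open>nat\<close>. The partial quotients of \<open>[0; a\<^sub>1, a\<^sub>2, \<dots>]\<close> are given by a sequence
  \<open>a\<close> whose entry \<open>a 0\<close> is never used.
\<close>

text \<open>\<open>cfrac [b\<^sub>1, \<dots>, b\<^sub>n]\<close> is the finite continued fraction \<open>[0; b\<^sub>1, \<dots>, b\<^sub>n]\<close>.\<close>

fun cfrac :: "nat list \<Rightarrow> real" where
  "cfrac [] = 0"
| "cfrac (b # bs) = 1 / (real b + cfrac bs)"

definition has_cfrac :: "real \<Rightarrow> (nat \<Rightarrow> nat) \<Rightarrow> bool" where
  "has_cfrac \<alpha> a \<longleftrightarrow>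
     (\<forall>i\<ge>1. a i \<ge> 1) \<and> (\<lambda>n. cfrac (map a [1..<Suc n])) \<longlonglongrightarrow> \<alpha>"

fun q :: "(nat \<Rightarrow> nat) \<Rightarrow> nat \<Rightarrow> nat" where
  "q a 0 = 1"
| "q a (Suc 0) = a 1"
| "q a (Suc (Suc k)) = a (Suc (Suc k)) * q a (Suc k) + q a k"

text \<open>Meaningful for \<open>k \<ge> 2\<close> only, as is \<open>semistd\<close> below.\<close>

definition q_semi :: "(nat \<Rightarrow> nat) \<Rightarrow> nat \<Rightarrow> nat \<Rightarrow> nat" where
  "q_semi a k l = l * q a (k - 1) + q a (k - 2)"

definition word_pow :: "nat list \<Rightarrow> nat \<Rightarrow> nat list" where
  "word_pow w p = concat (replicate p w)"

text \<open>The word \<open>s\<^bsub>-1\<^esub> = 1\<close> is left out: since \<open>s\<^sub>1\<close> is given explicitly, the recursion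
  starting at \<open>k = 2\<close> never refers to it.\<close>

fun std :: "(nat \<Rightarrow> nat) \<Rightarrow> nat \<Rightarrow> nat list" where
  "std a 0 = [0]"
| "std a (Suc 0) = replicate (a 1 - 1) 0 @ [1]"
| "std a (Suc (Suc k)) = word_pow (std a (Suc k)) (a (Suc (Suc k))) @ std a k"

definition semistd :: "(nat \<Rightarrow> nat) \<Rightarrow> nat \<Rightarrow> nat \<Rightarrow> nat list" where
  "semistd a k l = word_pow (std a (k - 1)) l @ std a (k - 2)"

text \<open>The cyclic shift moves the last letter to the front, so it is the inverse of
  \<^const>\<open>rotate1\<close>.\<close>

definition cshift :: "nat list \<Rightarrow> nat list" where
  "cshift w = (if w = [] then [] else last w # butlast w)"

definition conjugates :: "nat list \<Rightarrow> nat list set" where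
  "conjugates w = {(cshift ^^ i) w | i. i < length w}"

definition rot :: "real \<Rightarrow> real \<Rightarrow> real" where
  "rot \<alpha> x = frac (x + \<alpha>)"

definition rot_word :: "real \<Rightarrow> real \<Rightarrow> nat \<Rightarrow> nat" where
  "rot_word x \<alpha> n = (if (rot \<alpha> ^^ n) x \<in> {0..<1 - \<alpha>} then 0 else 1)"

definition factors :: "(nat \<Rightarrow> nat) \<Rightarrow> nat list set" where
  "factors s = {map s [i..<i + n] | i n. True}"

definition factors_len :: "nat list set \<Rightarrow> nat \<Rightarrow> nat list set" where
  "factors_len L n = {w \<in> L. length w = n}"

text \<open>The supremum is taken in \<^typ>\<open>enat\<close>, so that a finite value is a genuine maximum. If
  \<open>L\<close> is closed under factors, \<open>index L w \<ge> 1\<close> holds exactly for the words \<open>w \<in> L\<close>; the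
  supremum of the empty set is \<open>0\<close>.\<close>

definition index :: "nat list set \<Rightarrow> nat list \<Rightarrow> enat" where
  "index L w = Sup {enat p | p. p \<ge> 1 \<and> word_pow w p \<in> L}"

end

theory Submission
  imports Defs "HOL-Analysis.Kronecker_Approximation_Theorem"
begin

text \<open>
  The letters of the word of a point \<open>y\<close> are the increments of \<open>j \<mapsto> \<lfloor>y + j\<alpha>\<rfloor>\<close>. A power \<open>w\<^sup>p\<close> with
  \<open>p \<ge> 2\<close> and \<open>|w| = n\<close> therefore means \<open>\<lfloor>y + (j + n)\<alpha>\<rfloor> = \<lfloor>y + j\<alpha>\<rfloor> + c\<close> for \<open>j \<le> (p - 1)n\<close>, i.e. the
  orbit of \<open>y\<close> avoids an arc of length \<open>|n\<alpha> - c|\<close> next to \<open>0\<close>. By the three-gap argument this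
  forces \<open>(n, c)\<close> to be a multiple of a one-sided best approximation, that is, of a convergent or an
  intermediate fraction. If \<open>(n, c)\<close> is itself such an approximation and \<open>t\<close> is the first time at which
  the orbit of \<open>0\<close> comes closer to \<open>0\<close> than \<open>|n\<alpha> - c|\<close> on the other side, then the words of length \<open>n\<close> with a
  \<open>p\<close>-th power are exactly those of the points \<open>-m\<alpha>\<close> with \<open>m < n\<close> and \<open>(p - 1)n < m + t\<close>
  (for approximation from above; the other case is its mirror image). Shifting cyclically increases
  \<open>m\<close> by one modulo \<open>n\<close>, and the reversal of \<open>s\<^sub>k\<close> is the word with \<open>m = q\<^sub>k - q\<^bsub>k-1\<^esub> + 1\<close>, modulo \<open>q\<^sub>k\<close>.
\<close>

subsection \<open>Rotation words\<close>

lemma rational_mult_int: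
  fixes \<beta> :: real
  assumes "\<beta> \<notin> \<rat>" "real_of_int i * \<beta> = of_int c"
  shows "i = 0"
proof (rule ccontr)
  assume "i \<noteq> 0"
  then have "\<beta> = of_int c / of_int i" using assms(2) by (simp add: field_simps)
  then show False using assms(1) by (metis Rats_divide Rats_of_int)
qed

text \<open>For \<open>0 < \<alpha> < 1\<close> the words \<open>code \<alpha> y n\<close> are read off from the floor function; with \<open>\<beta> = - \<alpha>\<close>
  one gets the same language, read off from the ceiling function. Having both signs available
  lets every one-sided approximation statement be proved once.\<close>

definition code :: "real \<Rightarrow> real \<Rightarrow> nat \<Rightarrow> nat list" where
  "code \<beta> y n = map (\<lambda>j. nat \<bar>\<lfloor>y + real (Suc j) * \<beta>\<rfloor> - \<lfloor>y + real j * \<beta>\<rfloor>\<bar>) [0..<n]"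

definition codes :: "real \<Rightarrow> nat list set" where
  "codes \<beta> = {code \<beta> y n | y n. True}"

lemma length_code [simp]: "length (code \<beta> y n) = n"
  by (simp add: code_def)

lemma nth_code:
  "j < n \<Longrightarrow> code \<beta> y n ! j = nat \<bar>\<lfloor>y + real (Suc j) * \<beta>\<rfloor> - \<lfloor>y + real j * \<beta>\<rfloor>\<bar>"
  by (simp add: code_def)

lemma code_in_codes [simp]: "code \<beta> y n \<in> codes \<beta>"
  by (auto simp: codes_def)

lemma code_cong:
  assumes "\<And>j. j \<le> n \<Longrightarrow> \<lfloor>y' + real j * \<beta>\<rfloor> = \<lfloor>y + real j * \<beta>\<rfloor> + K"
  shows "code \<beta> y' n = code \<beta> y n"
  by (rule nth_equalityI) (auto simp: nth_code assms simp del: of_nat_Suc)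

lemma code_append: "code \<beta> y (n + m) = code \<beta> y n @ code \<beta> (y + real n * \<beta>) m"
proof (rule nth_equalityI)
  fix i assume "i < length (code \<beta> y (n + m))"
  then show "code \<beta> y (n + m) ! i = (code \<beta> y n @ code \<beta> (y + real n * \<beta>) m) ! i"
    by (cases "i < n") (auto simp: nth_append nth_code algebra_simps)
qed simp

lemma take_code: "m \<le> n \<Longrightarrow> take m (code \<beta> y n) = code \<beta> y m"
  using code_append[of \<beta> y m "n - m"] by simp

lemma floor_step:
  fixes \<beta> y :: real
  assumes "\<bar>\<beta>\<bar> < 1"
  shows "\<beta> \<ge> 0 \<Longrightarrow> \<lfloor>y + \<beta>\<rfloor> - \<lfloor>y\<rfloor> \<in> {0, 1}" "\<beta> \<le> 0 \<Longrightarrow> \<lfloor>y + \<beta>\<rfloor> - \<lfloor>y\<rfloor> \<in> {-1, 0}"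
  using assms by (auto; linarith)+

text \<open>All steps of the floor have the sign of \<open>\<beta>\<close>, so the absolute value in
  \<open>code\<close> loses nothing: letters turn back into signed increments.\<close>

lemma nth_code_diff:
  assumes "\<bar>\<beta>\<bar> < 1" "j < n"
  shows "\<lfloor>y + real (Suc j) * \<beta>\<rfloor> - \<lfloor>y + real j * \<beta>\<rfloor> = (if \<beta> \<ge> 0 then 1 else -1) * int (code \<beta> y n ! j)"
proof -
  have e: "y + real (Suc j) * \<beta> = (y + real j * \<beta>) + \<beta>" by (simp add: algebra_simps)
  show ?thesis
    using floor_step[OF assms(1), of "y + real j * \<beta>"] unfolding nth_code[OF assms(2)] e by auto
qed

lemma code_eq_floor:
  assumes "\<bar>\<beta>\<bar> < 1" "code \<beta> y n = code \<beta> y' n" "j \<le> n"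
  shows "\<lfloor>y + real j * \<beta>\<rfloor> - \<lfloor>y\<rfloor> = \<lfloor>y' + real j * \<beta>\<rfloor> - \<lfloor>y'\<rfloor>"
  using assms(3)
proof (induction j)
  case (Suc j)
  then show ?case
    using nth_code_diff[OF assms(1), of j n y] nth_code_diff[OF assms(1), of j n y'] assms(2) by auto
qed simp

lemma floor_code_sum:
  assumes "\<bar>\<beta>\<bar> < 1"
  shows "\<lfloor>y + real n * \<beta>\<rfloor> - \<lfloor>y\<rfloor> = (if \<beta> \<ge> 0 then 1 else -1) * int (sum_list (code \<beta> y n))"
proof (induction n)
  case (Suc n)
  have "code \<beta> y (Suc n) = code \<beta> y n @ [code \<beta> y (Suc n) ! n]"
    by (rule nth_equalityI) (auto simp: nth_append nth_code less_Suc_eq)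
  then have "sum_list (code \<beta> y (Suc n)) = sum_list (code \<beta> y n) + code \<beta> y (Suc n) ! n"
    by (metis sum_list.Cons sum_list.Nil sum_list_append add_0_right)
  then show ?case
    using Suc nth_code_diff[OF assms, of n "Suc n" y] by (auto simp: algebra_simps split: if_splits)
qed (simp add: code_def)

text \<open>Finitely many orbit points leave a common margin before the next integer. A small move
  of \<open>y\<close> to the right therefore preserves all their floors.\<close>

lemma floor_right_stable:
  fixes y \<beta> :: real and N :: nat
  obtains \<epsilon> where "\<epsilon> > 0"
    "\<And>j \<delta>. j \<le> N \<Longrightarrow> 0 \<le> \<delta> \<Longrightarrow> \<delta> < \<epsilon> \<Longrightarrow> frac (y + real j * \<beta>) + \<delta> < 1"
proof
  let ?S = "(\<lambda>j. 1 - frac (y + real j * \<beta>)) ` {..N}"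
  show "Min ?S > 0" by (auto simp: frac_lt_1)
  fix j \<delta> assume j: "j \<le> N" "\<delta> < Min ?S"
  have "Min ?S \<le> 1 - frac (y + real j * \<beta>)" using j by (intro Min_le) auto
  then show "frac (y + real j * \<beta>) + \<delta> < 1" using j by linarith
qed

text \<open>Reflecting the orbit at 0 turns floors into ceilings. After a small move to the right no
  orbit point is an integer, so the two differ by the constant 1 and the letters agree.\<close>

lemma codes_uminus_subset: "codes \<beta> \<subseteq> codes (- \<beta>)"
proof
  fix w assume "w \<in> codes \<beta>"
  then obtain y n where w: "w = code \<beta> y n" by (auto simp: codes_def)
  obtain \<epsilon> where e: "\<epsilon> > 0"
    "\<And>j \<delta>. j \<le> n \<Longrightarrow> 0 \<le> \<delta> \<Longrightarrow> \<delta> < \<epsilon> \<Longrightarrow> frac (y + real j * \<beta>) + \<delta> < 1"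
    using floor_right_stable[of n y \<beta>] by blast
  have "\<lfloor>- (y + \<epsilon>/2) + real j * (- \<beta>)\<rfloor> = - \<lfloor>y + real j * \<beta>\<rfloor> - 1" if "j \<le> n" for j
  proof -
    have "frac (y + real j * \<beta>) + \<epsilon>/2 < 1" "frac (y + real j * \<beta>) \<ge> 0" using e that by auto
    then show ?thesis using e(1) by (simp add: frac_def floor_eq_iff) linarith
  qed
  then have "w = code (- \<beta>) (- (y + \<epsilon>/2)) n"
    unfolding w by (intro nth_equalityI) (auto simp: nth_code simp del: of_nat_Suc mult_minus_right)
  then show "w \<in> codes (- \<beta>)" by simp
qed

lemma codes_uminus: "codes (- \<beta>) = codes \<beta>"
  using codes_uminus_subset[of \<beta>] codes_uminus_subset[of "- \<beta>"] by auto

section \<open>The rotation word as a floor coding\<close>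

lemma rot_funpow: "0 \<le> x \<Longrightarrow> x < 1 \<Longrightarrow> (rot \<alpha> ^^ n) x = frac (x + real n * \<alpha>)"
proof (induction n)
  case (Suc n)
  have "frac (frac (x + real n * \<alpha>) + \<alpha>) = frac (x + real n * \<alpha> + \<alpha>)"
    by (metis frac_add_simps(1))
  then show ?case using Suc by (simp add: rot_def algebra_simps)
qed (simp add: frac_eq)

lemma rot_word_eq:
  assumes "0 < \<alpha>" "\<alpha> < 1" "0 \<le> x" "x < 1"
  shows "rot_word x \<alpha> j = nat \<bar>\<lfloor>x + real (Suc j) * \<alpha>\<rfloor> - \<lfloor>x + real j * \<alpha>\<rfloor>\<bar>"
proof -
  define z where "z = x + real j * \<alpha>"
  have e: "x + real (Suc j) * \<alpha> = z + \<alpha>" by (simp add: z_def algebra_simps)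
  have "frac z = z - \<lfloor>z\<rfloor>" "0 \<le> frac z" "frac z < 1" by (simp_all only: frac_def[of z, symmetric] frac_ge_0 frac_lt_1)
  then have "frac z < 1 - \<alpha> \<Longrightarrow> \<lfloor>z + \<alpha>\<rfloor> = \<lfloor>z\<rfloor>" "\<not> frac z < 1 - \<alpha> \<Longrightarrow> \<lfloor>z + \<alpha>\<rfloor> = \<lfloor>z\<rfloor> + 1"
    using assms by (simp_all add: floor_eq_iff; linarith)+
  then show ?thesis
    unfolding rot_word_def rot_funpow[OF assms(3,4)] e unfolding z_def[symmetric]
    by (auto simp: frac_lt_1)
qed

lemma factors_rot_word:
  assumes "0 < \<alpha>" "\<alpha> < 1" "\<alpha> \<notin> \<rat>" "0 \<le> x" "x < 1"
  shows "factors (rot_word x \<alpha>) = codes \<alpha>"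
proof -
  have m: "map (rot_word x \<alpha>) [i..<i + n] = code \<alpha> (x + real i * \<alpha>) n" for i n
    by (rule nth_equalityI) (auto simp: nth_code rot_word_eq[OF assms(1,2,4,5)] algebra_simps)
  have "\<exists>i. code \<alpha> y n = code \<alpha> (x + real i * \<alpha>) n" for y n
  proof -
    obtain \<epsilon> where e: "\<epsilon> > 0"
      "\<And>j \<delta>. j \<le> n \<Longrightarrow> 0 \<le> \<delta> \<Longrightarrow> \<delta> < \<epsilon> \<Longrightarrow> frac (y + real j * \<alpha>) + \<delta> < 1"
      using floor_right_stable[of n y \<alpha>] by blast
    \<comment> \<open>Aiming at \<open>y + \<epsilon>/2\<close> with tolerance
      \<open>\<epsilon>/2\<close> puts an orbit point of \<open>x\<close> to the right of
      \<open>y\<close> by less than \<open>\<epsilon>\<close>, modulo 1. There the floors agree with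
      those of \<open>y\<close> up to a common integer.\<close>
    obtain k where k: "\<bar>frac (real k * \<alpha>) - frac (y - x + \<epsilon>/2)\<bar> < \<epsilon>/2"
      using Kronecker_approx_1_explicit[OF assms(3), of "frac (y - x + \<epsilon>/2)" "\<epsilon>/2"] e(1)
      by (metis frac_ge_0 frac_lt_1 half_gt_zero less_imp_le)
    define \<delta> where "\<delta> = \<epsilon>/2 + (frac (real k * \<alpha>) - frac (y - x + \<epsilon>/2))"
    define K where "K = \<lfloor>real k * \<alpha>\<rfloor> - \<lfloor>y - x + \<epsilon>/2\<rfloor>"
    have d: "0 \<le> \<delta>" "\<delta> < \<epsilon>" using k unfolding \<delta>_def by linarith+
    have "\<lfloor>x + real k * \<alpha> + real j * \<alpha>\<rfloor> = \<lfloor>y + real j * \<alpha>\<rfloor> + K" if "j \<le> n" for j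
    proof -
      have "x + real k * \<alpha> + real j * \<alpha> = y + real j * \<alpha> + \<delta> + K"
        by (simp add: \<delta>_def K_def frac_def)
      then show ?thesis using e(2)[OF that d] d by (simp add: frac_def floor_eq_iff) linarith
    qed
    then show ?thesis by (intro exI[of _ k] sym[OF code_cong[where K = K]])
  qed
  then have "codes \<alpha> \<subseteq> factors (rot_word x \<alpha>)" unfolding factors_def codes_def m by fast
  moreover have "factors (rot_word x \<alpha>) \<subseteq> codes \<alpha>" unfolding factors_def codes_def m by fast
  ultimately show ?thesis by (rule subset_antisym[rotated])
qed

subsection \<open>Powers and periods\<close>

lemma word_pow_0 [simp]: "word_pow w 0 = []"
  and word_pow_Suc [simp]: "word_pow w (Suc p) = w @ word_pow w p"
  by (simp_all add: word_pow_def)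

lemma word_pow_1 [simp]: "word_pow w 1 = w"
  by (simp add: word_pow_def)

lemma length_word_pow [simp]: "length (word_pow w p) = p * length w"
  by (induction p) auto

lemma word_pow_add: "word_pow w (p + r) = word_pow w p @ word_pow w r"
  by (induction p) auto

lemma word_pow_Suc_right: "word_pow w (Suc p) = word_pow w p @ w"
  using word_pow_add[of w p 1] by simp

lemma word_pow_mult: "word_pow (word_pow w e) p = word_pow w (e * p)"
  by (induction p) (auto simp: word_pow_add)

lemma codes_prefix: "u @ v \<in> codes \<beta> \<Longrightarrow> u \<in> codes \<beta>"
proof -
  assume "u @ v \<in> codes \<beta>"
  then obtain y n where "u @ v = code \<beta> y n" by (auto simp: codes_def)
  moreover have "length u \<le> n" using arg_cong[OF calculation, of length] by simp
  ultimately have "u = code \<beta> y (length u)" by (metis append_eq_conv_conj take_code)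
  then show ?thesis by (metis code_in_codes)
qed

lemma word_pow_codes_mono: "word_pow w p \<in> codes \<beta> \<Longrightarrow> r \<le> p \<Longrightarrow> word_pow w r \<in> codes \<beta>"
  using word_pow_add[of w r "p - r"] codes_prefix by auto

text \<open>Periodicity in terms of floors: the first \<open>M + n\<close> letters have period
  \<open>n\<close>. For \<open>\<bar>\<beta>\<bar> < 1\<close>, \<open>c\<close> is the signed
  number of ones in a window of length \<open>n\<close>.\<close>

definition floor_period :: "real \<Rightarrow> nat \<Rightarrow> int \<Rightarrow> real \<Rightarrow> nat \<Rightarrow> bool" where
  "floor_period \<beta> n c y M \<longleftrightarrow> (\<forall>j\<le>M. \<lfloor>y + real (j + n) * \<beta>\<rfloor> = \<lfloor>y + real j * \<beta>\<rfloor> + c)"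

lemma floor_period_D:
  "floor_period \<beta> n c y M \<Longrightarrow> j \<le> M \<Longrightarrow> \<lfloor>y + real (j + n) * \<beta>\<rfloor> = \<lfloor>y + real j * \<beta>\<rfloor> + c"
  by (simp add: floor_period_def)

lemma floor_period_mono: "floor_period \<beta> n c y M \<Longrightarrow> M' \<le> M \<Longrightarrow> floor_period \<beta> n c y M'"
  by (auto simp: floor_period_def)

text \<open>Adding \<open>n\<beta>\<close> moves a point to the right by \<open>n\<beta> - c\<close>
  modulo 1, and the floor grows by exactly \<open>c\<close> iff this move crosses no
  integer.\<close>

lemma floor_period_iff_frac:
  assumes "real n * \<beta> - of_int c \<ge> 0"
  shows "floor_period \<beta> n c y M \<longleftrightarrow> (\<forall>j\<le>M. frac (y + real j * \<beta>) < 1 - (real n * \<beta> - of_int c))"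
proof -
  have "\<lfloor>y + real (j + n) * \<beta>\<rfloor> = \<lfloor>y + real j * \<beta>\<rfloor> + c \<longleftrightarrow>
      frac (y + real j * \<beta>) < 1 - (real n * \<beta> - of_int c)" for j
    using assms unfolding frac_def floor_eq_iff by (simp add: algebra_simps) linarith
  then show ?thesis by (simp add: floor_period_def)
qed

lemma floor_period_word_pow:
  assumes "floor_period \<beta> n c y ((p - 1) * n)" "p \<ge> 1"
  shows "code \<beta> y (p * n) = word_pow (code \<beta> y n) p"
  using assms(2,1)
proof (induction p rule: dec_induct)
  case (step p)
  obtain r where r: "p = Suc r" using step.hyps by (cases p) auto
  have "code \<beta> (y + real n * \<beta>) (p * n) = code \<beta> y (p * n)"
    using floor_period_D[OF step.prems] by (intro code_cong[where K = c]) (auto simp: algebra_simps)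
  moreover have "code \<beta> y (p * n) = word_pow (code \<beta> y n) p"
    using step.IH floor_period_mono[OF step.prems] r by simp
  ultimately show ?case by (simp add: code_append)
qed simp

text \<open>Deleting the first or the last copy of \<open>w\<close> leaves the same word, so the
  codes at \<open>y\<close> and \<open>y + n\<beta>\<close> agree. Equal codes have equal floor
  increments, and the offset \<open>c\<close> is read off at \<open>j = 0\<close>.\<close>

lemma word_pow_floor_period:
  assumes b: "\<bar>\<beta>\<bar> < 1" and w: "code \<beta> y (p * n) = word_pow w p" "length w = n" and p: "p \<ge> 1"
  defines "c \<equiv> (if \<beta> \<ge> 0 then 1 else -1) * int (sum_list w)"
  shows "code \<beta> y n = w" "floor_period \<beta> n c y ((p - 1) * n)"
proof -
  obtain r where r: "p = Suc r" using p by (cases p) auto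
  have s1: "code \<beta> y n @ code \<beta> (y + real n * \<beta>) (r * n) = w @ word_pow w r"
    using w(1) unfolding r by (simp add: code_append)
  have s2: "code \<beta> y (r * n) @ code \<beta> (y + real (r * n) * \<beta>) n = word_pow w r @ w"
    using w(1) unfolding r word_pow_Suc_right by (metis code_append mult_Suc add.commute)
  show 1: "code \<beta> y n = w" using s1 w(2) by simp
  have 2: "code \<beta> (y + real n * \<beta>) (r * n) = code \<beta> y (r * n)"
    using s1 s2 w(2) by simp
  have c: "\<lfloor>y + real n * \<beta>\<rfloor> - \<lfloor>y\<rfloor> = c"
    unfolding c_def using floor_code_sum[OF b, of y n] 1 by simp
  show "floor_period \<beta> n c y ((p - 1) * n)" unfolding floor_period_def
  proof (intro allI impI)
    fix j assume "j \<le> (p - 1) * n"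
    then have "j \<le> r * n" using r by simp
    from code_eq_floor[OF b 2 this] c show "\<lfloor>y + real (j + n) * \<beta>\<rfloor> = \<lfloor>y + real j * \<beta>\<rfloor> + c"
      by (simp add: algebra_simps)
  qed
qed

subsection \<open>Orbit words and unimodular pairs\<close>

text \<open>The points \<open>-m\<beta>\<close> with \<open>m \<le> n\<close> cut the circle into
  the arcs on which the word of length \<open>n\<close> is constant; \<open>m\<close> names an arc
  by its left endpoint.\<close>

definition orbit_word :: "real \<Rightarrow> nat \<Rightarrow> nat \<Rightarrow> nat list" where
  "orbit_word \<beta> n m = code \<beta> (- (real m * \<beta>)) n"

lemma length_orbit_word [simp]: "length (orbit_word \<beta> n m) = n"
  by (simp add: orbit_word_def)

lemma orbit_word_in_codes [simp]: "orbit_word \<beta> n m \<in> codes \<beta>"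
  by (simp add: orbit_word_def)

text \<open>The point of \<open>{-m\<beta> | m \<le> M}\<close> closest to \<open>y\<close> on the left (mod 1) has the same word as \<open>y\<close>.\<close>

lemma left_endpoint:
  fixes y \<beta> :: real
  obtains m K where "m \<le> M"
    "\<And>j. j \<le> M \<Longrightarrow> frac (y + real m * \<beta>) \<le> frac (y + real j * \<beta>)"
    "\<And>j. j \<le> M \<Longrightarrow> \<lfloor>y + real j * \<beta>\<rfloor> = \<lfloor>- (real m * \<beta>) + real j * \<beta>\<rfloor> + K"
proof -
  obtain m where m: "m \<le> M" "\<And>j. j \<le> M \<Longrightarrow> frac (y + real m * \<beta>) \<le> frac (y + real j * \<beta>)"
    using ex_is_arg_min_if_finite[of "{..M}" "\<lambda>j. frac (y + real j * \<beta>)"]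
    by (auto simp: is_arg_min_linorder)
  have "\<lfloor>y + real j * \<beta>\<rfloor> = \<lfloor>- (real m * \<beta>) + real j * \<beta>\<rfloor> + \<lfloor>y + real m * \<beta>\<rfloor>" if "j \<le> M" for j
  proof -
    define x where "x = - (real m * \<beta>) + real j * \<beta>"
    define z where "z = y + real m * \<beta>"
    have e: "y + real j * \<beta> = x + z" by (simp add: x_def z_def)
    have "frac z \<le> frac (x + z)" using m(2)[OF that] unfolding e z_def .
    \<comment> \<open>A carry would give \<open>frac (x + z) = frac x + frac z - 1 < frac z\<close>,
      against the choice of \<open>m\<close>.\<close>
    then have "\<not> frac x + frac z \<ge> 1" using frac_lt_1[of x] by (auto simp: frac_add split: if_splits)
    then have "\<lfloor>x + z\<rfloor> = \<lfloor>x\<rfloor> + \<lfloor>z\<rfloor>" by (simp add: floor_add)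
    then show ?thesis unfolding e by (simp add: x_def z_def)
  qed
  then show ?thesis using that m by blast
qed

lemma code_orbit_word:
  obtains m where "m \<le> n" "code \<beta> y n = orbit_word \<beta> n m"
  using left_endpoint[of n y \<beta>] code_cong[of n y \<beta>] unfolding orbit_word_def by metis

text \<open>The two orbits pass through 0 at the times \<open>m\<close> and \<open>m'\<close>.
  Comparing floors at both times gives
  \<open>\<lfloor>-i\<beta>\<rfloor> = -\<lfloor>i\<beta>\<rfloor>\<close> for the difference
  \<open>i > 0\<close>, which irrationality excludes.\<close>

lemma orbit_word_inj:
  assumes "\<beta> \<notin> \<rat>" "\<bar>\<beta>\<bar> < 1" "m \<le> n" "m' \<le> n" "orbit_word \<beta> n m = orbit_word \<beta> n m'"
  shows "m = m'"
proof -
  have aux: False if "m < m'" "m' \<le> n" "orbit_word \<beta> n m = orbit_word \<beta> n m'" for m m'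
  proof -
    define i where "i = m' - m"
    have i: "m' = m + i" "i > 0" using that by (auto simp: i_def)
    note f = code_eq_floor[OF assms(2) that(3)[unfolded orbit_word_def]]
    have "real_of_int \<lfloor>real i * \<beta>\<rfloor> \<noteq> real i * \<beta>"
      using rational_mult_int[OF assms(1), of "int i" "\<lfloor>real i * \<beta>\<rfloor>"] i by auto
    then have "\<lfloor>- (real i * \<beta>)\<rfloor> \<noteq> - \<lfloor>real i * \<beta>\<rfloor>"
      by (metis minus_minus neg_le_iff_le of_int_floor_le of_int_minus order_antisym)
    then show False
      using f[of m] f[of m'] that i by (simp add: algebra_simps)
  qed
  show ?thesis using aux[of m m'] aux[of m' m] assms by (metis linorder_neqE_nat)
qed

text \<open>A unimodular pair: \<open>n\<beta>\<close> approaches the integers from above with error \<open>n\<beta> - c\<close>, \<open>t\<beta>\<close> from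
  below with error \<open>d - t\<beta>\<close>, and \<open>(n, c)\<close>, \<open>(t, d)\<close> form a basis of the integer lattice.\<close>

definition unimod :: "real \<Rightarrow> nat \<Rightarrow> int \<Rightarrow> nat \<Rightarrow> int \<Rightarrow> bool" where
  "unimod \<beta> n c t d \<longleftrightarrow> int n * d - int t * c = 1 \<and> of_int c < real n * \<beta> \<and> real t * \<beta> < of_int d"

lemma unimod_swap: "unimod \<beta> n c t d \<Longrightarrow> unimod (- \<beta>) t (- d) n (- c)"
  by (auto simp: unimod_def algebra_simps)

lemma unimod_add:
  "unimod \<beta> n c t d \<Longrightarrow> real (t + l * n) * \<beta> < of_int (d + int l * c) \<Longrightarrow>
    unimod \<beta> n c (t + l * n) (d + int l * c)"
  by (auto simp: unimod_def algebra_simps)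

text \<open>Cramer's rule with determinant 1 keeps the coordinates integral. As \<open>A\<close> and
  \<open>B\<close> are positive, the size of an error restricts the signs of \<open>u\<close> and
  \<open>v\<close>, and these in turn bound the denominator \<open>i\<close>.\<close>

lemma unimod_coords:
  assumes "unimod \<beta> n c t d"
  defines "A \<equiv> real n * \<beta> - of_int c" and "B \<equiv> of_int d - real t * \<beta>"
  obtains u v where "i = u * int n + v * int t" "g = u * c + v * d"
    "of_int i * \<beta> - of_int g = of_int u * A - of_int v * B"
proof
  define u v where "u = i * d - int t * g" and "v = int n * g - i * c"
  have 1: "int n * d - int t * c = 1" using assms by (simp add: unimod_def)
  have "u * int n + v * int t = i * (int n * d - int t * c)"
    by (simp add: u_def v_def algebra_simps)
  then show i: "i = u * int n + v * int t" using 1 by simp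
  have "u * c + v * d = g * (int n * d - int t * c)"
    by (simp add: u_def v_def algebra_simps)
  then show g: "g = u * c + v * d" using 1 by simp
  show "of_int i * \<beta> - of_int g = of_int u * A - of_int v * B"
    unfolding A_def B_def by (subst i, subst g) (simp add: algebra_simps)
qed

lemma mult_le_self_neg: "(u::int) \<le> -1 \<Longrightarrow> 0 < A \<Longrightarrow> of_int u * A \<le> - (A::real)"
  using mult_right_mono[of "of_int u" "-1" A] by simp

text \<open>Only an integer \<open>g\<close> with \<open>i\<beta> < g \<le> i\<beta> + A\<close>
  could spoil this. In the coordinates of \<open>(i, g)\<close>, \<open>v \<ge> 1\<close> forces
  \<open>u \<ge> 0\<close> and so \<open>i \<ge> t\<close>, while \<open>v \<le> 0\<close> forces
  \<open>u \<le> -1\<close> and so \<open>i \<le> -n\<close>.\<close>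

lemma unimod_floor_add:
  assumes U: "unimod \<beta> n c t d" and i: "- int n < i" "i < int t"
  shows "\<lfloor>of_int (i + int n) * \<beta>\<rfloor> = \<lfloor>of_int i * \<beta>\<rfloor> + c"
proof -
  define A B where "A = real n * \<beta> - of_int c" and "B = of_int d - real t * \<beta>"
  have AB: "A > 0" "B > 0" using U by (auto simp: unimod_def A_def B_def)
  define g where "g = \<lfloor>of_int i * \<beta>\<rfloor> + 1"
  obtain u v where uv: "i = u * int n + v * int t" "of_int i * \<beta> - of_int g = of_int u * A - of_int v * B"
    using unimod_coords[OF U, of i g] A_def B_def by metis
  have "of_int i * \<beta> + A < of_int g"
  proof (rule ccontr)
    assume "\<not> ?thesis"
    then have 1: "- A \<le> of_int u * A - of_int v * B" using uv(2) by linarith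
    have 2: "of_int u * A - of_int v * B < 0" unfolding uv(2)[symmetric] g_def by linarith
    show False
    proof (cases "v \<ge> 1")
      case True
      then have vB: "of_int v * B \<ge> B" using AB mult_right_mono[of 1 "of_int v" B] by simp
      have "u \<ge> 0"
      proof (rule ccontr)
        assume "\<not> u \<ge> 0"
        then show False using mult_le_self_neg[of u A] AB 1 vB by linarith
      qed
      then have "i \<ge> int t"
        using True uv(1) mult_right_mono[of 1 v "int t"] by (simp add: add_increasing)
      then show False using i by simp
    next
      case False
      then have "of_int v * B \<le> 0" using AB by (simp add: mult_nonpos_nonneg)
      then have "of_int u * A < 0" using 2 by linarith
      then have "u \<le> -1" using AB by (simp add: mult_less_0_iff)
      then have "u * int n \<le> - int n" using mult_right_mono[of u "-1" "int n"] by simp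
      moreover have "v * int t \<le> 0" using False by (simp add: mult_nonpos_nonneg)
      ultimately show False using i uv(1) by linarith
    qed
  qed
  then have "\<lfloor>of_int i * \<beta> + A\<rfloor> = \<lfloor>of_int i * \<beta>\<rfloor>"
    using AB unfolding g_def by (intro floor_unique) (auto, linarith)
  moreover have "of_int (i + int n) * \<beta> = (of_int i * \<beta> + A) + of_int c"
    by (simp add: A_def algebra_simps)
  ultimately show ?thesis by simp
qed

text \<open>An integer \<open>g\<close> with \<open>i\<beta> - B < g \<le> i\<beta>\<close> would
  have coordinates that are both nonnegative or both negative, hence \<open>i \<ge> 0\<close> or
  \<open>i \<le> -(n + t)\<close>.\<close>

lemma unimod_floor_add_below:
  assumes U: "unimod \<beta> n c t d" and i: "- int (n + t) < i" "i < 0"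
  shows "\<lfloor>of_int (i + int t) * \<beta>\<rfloor> = \<lfloor>of_int i * \<beta>\<rfloor> + d"
proof -
  define A B where "A = real n * \<beta> - of_int c" and "B = of_int d - real t * \<beta>"
  have AB: "A > 0" "B > 0" using U by (auto simp: unimod_def A_def B_def)
  define g where "g = \<lfloor>of_int i * \<beta>\<rfloor>"
  obtain u v where uv: "i = u * int n + v * int t" "of_int i * \<beta> - of_int g = of_int u * A - of_int v * B"
    using unimod_coords[OF U, of i g] A_def B_def by metis
  have "of_int g + B \<le> of_int i * \<beta>"
  proof (rule ccontr)
    assume "\<not> ?thesis"
    then have 1: "of_int u * A - of_int v * B < B" using uv(2) by linarith
    have 2: "of_int u * A - of_int v * B \<ge> 0" unfolding uv(2)[symmetric] g_def by linarith
    show False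
    proof (cases "v \<ge> 0")
      case True
      then have "of_int v * B \<ge> 0" using AB by simp
      then have "of_int u * A \<ge> 0" using 2 by linarith
      then have "u \<ge> 0" using AB by (simp add: zero_le_mult_iff)
      then have "u * int n \<ge> 0" "v * int t \<ge> 0" using True by simp_all
      then show False using uv(1) i by linarith
    next
      case False
      then have vB: "of_int v * B \<le> - B" using mult_le_self_neg AB by simp
      then have "of_int u * A < 0" using 1 by linarith
      then have "u \<le> -1" using AB by (simp add: mult_less_0_iff)
      then have "u * int n \<le> - int n" using mult_right_mono[of u "-1" "int n"] by simp
      moreover have "v * int t \<le> - int t" using False mult_right_mono[of v "-1" "int t"] by simp
      ultimately show False using i uv(1) by simp
    qed
  qed
  then have "\<lfloor>of_int i * \<beta> - B\<rfloor> = \<lfloor>of_int i * \<beta>\<rfloor>"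
    using AB unfolding g_def by (intro floor_unique) (auto, linarith)
  moreover have "of_int (i + int t) * \<beta> = (of_int i * \<beta> - B) + of_int d"
    by (simp add: B_def algebra_simps)
  ultimately show ?thesis by simp
qed

section \<open>Periods along orbits\<close>

lemma unimod_period:
  assumes U: "unimod \<beta> n c t d" and "m < n" "M < m + t"
  shows "floor_period \<beta> n c (- (real m * \<beta>)) M"
  unfolding floor_period_def
proof (intro allI impI)
  fix j assume "j \<le> M"
  then show "\<lfloor>- (real m * \<beta>) + real (j + n) * \<beta>\<rfloor> = \<lfloor>- (real m * \<beta>) + real j * \<beta>\<rfloor> + c"
    using unimod_floor_add[OF U, of "int j - int m"] assms by (simp add: algebra_simps)
qed

text \<open>Let \<open>-m\<beta>\<close> be the left endpoint for all times up to \<open>M\<close>.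
  If \<open>m \<ge> n\<close>, the point at time \<open>m - n\<close> has a smaller fractional part.
  If \<open>m + t \<le> M\<close>, the point at time \<open>m + t\<close> lies \<open>B\<close>
  further left: it has a smaller fractional part or wraps around into the final arc of length
  \<open>B < A\<close>, which the period forbids.\<close>

lemma unimod_period_orbit:
  assumes U: "unimod \<beta> n c t d" and less: "of_int d - real t * \<beta> < real n * \<beta> - of_int c"
    and P: "floor_period \<beta> n c y M" and M: "n \<le> M"
  obtains m where "m < n" "M < m + t" "code \<beta> y n = orbit_word \<beta> n m"
proof -
  define A B where "A = real n * \<beta> - of_int c" and "B = of_int d - real t * \<beta>"
  have AB: "A > 0" "B > 0" "B < A" using U less by (auto simp: unimod_def A_def B_def)
  have P': "frac (y + real j * \<beta>) < 1 - A" if "j \<le> M" for j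
    using floor_period_iff_frac[of n \<beta> c y M] P AB(1) that unfolding A_def by auto
  obtain m K where m: "m \<le> M"
    "\<And>j. j \<le> M \<Longrightarrow> frac (y + real m * \<beta>) \<le> frac (y + real j * \<beta>)"
    "\<And>j. j \<le> M \<Longrightarrow> \<lfloor>y + real j * \<beta>\<rfloor> = \<lfloor>- (real m * \<beta>) + real j * \<beta>\<rfloor> + K"
    using left_endpoint[of M y \<beta>] by blast
  have "m < n"
  proof (rule ccontr)
    assume "\<not> m < n"
    then have j: "m - n \<le> M" "m - n + n = m" using m(1) by auto
    from floor_period_D[OF P j(1)]
    have "\<lfloor>y + real m * \<beta>\<rfloor> = \<lfloor>y + real (m - n) * \<beta>\<rfloor> + c" unfolding j(2) .
    moreover have "real m * \<beta> = real (m - n) * \<beta> + real n * \<beta>"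
      using j(2) by (metis distrib_right of_nat_add)
    ultimately have "frac (y + real m * \<beta>) = frac (y + real (m - n) * \<beta>) + A"
      unfolding frac_def A_def by linarith
    then show False using m(2)[OF j(1)] AB by linarith
  qed
  moreover have "M < m + t"
  proof (rule ccontr)
    assume "\<not> M < m + t"
    then have j: "m + t \<le> M" by simp
    define z where "z = y + real m * \<beta>"
    have e: "y + real (m + t) * \<beta> = z - B + of_int d" by (simp add: z_def B_def algebra_simps)
    have f: "frac (y + real (m + t) * \<beta>) = frac (z - B)" unfolding e by simp
    have 1: "frac z \<le> frac (z - B)" using m(2)[OF j] unfolding f z_def .
    have 2: "frac z < 1 - A" using P'[OF m(1)] by (simp add: z_def)
    have 3: "frac (z - B) < 1 - A" using P'[OF j] unfolding f .
    have "frac z - B < 0"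
    proof (rule ccontr)
      assume "\<not> ?thesis"
      then have "\<lfloor>z - B\<rfloor> = \<lfloor>z\<rfloor>"
        using AB frac_lt_1[of z] unfolding frac_def by (intro floor_unique) linarith+
      then show False using 1 AB unfolding frac_def by linarith
    qed
    then have "\<lfloor>z - B\<rfloor> \<le> \<lfloor>z\<rfloor> - 1" unfolding frac_def by linarith
    then have "frac (z - B) \<ge> z - B - of_int \<lfloor>z\<rfloor> + 1" unfolding frac_def by linarith
    then show False using 3 AB frac_ge_0[of z] unfolding frac_def[of z] by linarith
  qed
  moreover have "code \<beta> y n = orbit_word \<beta> n m"
    unfolding orbit_word_def using m(3) M by (intro code_cong[where K = K]) auto
  ultimately show ?thesis using that by blast
qed

text \<open>Choose \<open>j\<close> with the largest fractional part: one of \<open>j + n\<close>, \<open>j - t\<close>, \<open>j + n - t\<close> is again in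
  \<open>[0, N]\<close>, and moving there would increase the fractional part further unless it wraps around.\<close>

lemma three_gap_bound:
  fixes y :: real
  assumes U: "unimod \<beta> n c t d" and N: "n \<le> N" "t \<le> N" "N < n + t"
  obtains j where "j \<le> N"
    "frac (y + real j * \<beta>) \<ge> 1 - ((real n * \<beta> - of_int c) + (of_int d - real t * \<beta>))"
proof -
  define A B where "A = real n * \<beta> - of_int c" and "B = of_int d - real t * \<beta>"
  have AB: "A > 0" "B > 0" using U by (auto simp: unimod_def A_def B_def)
  have key: "frac (y + real j * \<beta>) \<ge> 1 - D"
    if "frac (y + real i * \<beta>) \<le> frac (y + real j * \<beta>)"
      "real i * \<beta> = real j * \<beta> + D + of_int g" "D > 0" for i j D and g :: int
  proof (rule ccontr)
    assume *: "\<not> ?thesis"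
    have "y + real i * \<beta> = (y + real j * \<beta> + D) + of_int g" using that(2) by simp
    then have f: "frac (y + real i * \<beta>) = frac (y + real j * \<beta> + D)" by (simp only: frac_add_of_int_right)
    have "\<lfloor>y + real j * \<beta> + D\<rfloor> = \<lfloor>y + real j * \<beta>\<rfloor>"
      using * that(3) frac_ge_0[of "y + real j * \<beta>"] unfolding frac_def by (intro floor_unique) linarith+
    then show False using that(1,3) f unfolding frac_def by linarith
  qed
  obtain j where j: "j \<le> N" "\<And>i. i \<le> N \<Longrightarrow> frac (y + real i * \<beta>) \<le> frac (y + real j * \<beta>)"
    using ex_is_arg_min_if_finite[of "{..N}" "\<lambda>i. - frac (y + real i * \<beta>)"]
    by (auto simp: is_arg_min_linorder)
  have "frac (y + real j * \<beta>) \<ge> 1 - (A + B)"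
  proof -
    consider "j + n \<le> N" | "t \<le> j" | "N < j + n" "j < t" by linarith
    then show ?thesis
    proof cases
      case 1
      have "frac (y + real j * \<beta>) \<ge> 1 - A"
        using AB by (intro key[of "j + n" j A c] j) (auto simp: 1 A_def algebra_simps)
      then show ?thesis using AB by linarith
    next
      case 2
      have "frac (y + real j * \<beta>) \<ge> 1 - B"
        using AB 2 j(1) by (intro key[of "j - t" j B "- d"] j) (auto simp: B_def of_nat_diff algebra_simps)
      then show ?thesis using AB by linarith
    next
      case 3
      then have le: "t \<le> j + n" "j + n - t \<le> N" using N by auto
      show ?thesis
        using AB le by (intro key[of "j + n - t" j "A + B" "c - d"] j) (auto simp: A_def B_def of_nat_diff algebra_simps)
    qed
  qed
  then show ?thesis using that j(1) unfolding A_def B_def by blast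
qed

text \<open>Write \<open>(N, C)\<close> in the basis with coordinates \<open>u\<close>,
  \<open>v\<close>. A positive error forces \<open>u \<ge> 1\<close>. If \<open>v < 0\<close>, the
  forbidden arc has length at least \<open>A + B\<close>, and the three-gap bound puts an orbit
  point into it. If \<open>v \<ge> 1\<close>, then \<open>N \<ge> n + t\<close>. Hence
  \<open>v = 0\<close>.\<close>

lemma period_multiple:
  assumes U: "unimod \<beta> n c t d" and N: "n \<le> N" "t \<le> N" "N < n + t"
    and P: "floor_period \<beta> N C y N" and pos: "of_int C < real N * \<beta>"
  obtains e where "N = e * n" "C = int e * c"
proof -
  define A B where "A = real n * \<beta> - of_int c" and "B = of_int d - real t * \<beta>"
  have AB: "A > 0" "B > 0" using U by (auto simp: unimod_def A_def B_def)
  obtain u v where uv: "int N = u * int n + v * int t" "C = u * c + v * d"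
    "real N * \<beta> - of_int C = of_int u * A - of_int v * B"
    using unimod_coords[OF U, of "int N" C] unfolding A_def B_def by (metis of_int_of_nat_eq)
  have u: "u \<ge> 1"
  proof (rule ccontr)
    assume "\<not> u \<ge> 1"
    then have u: "u \<le> 0" by simp
    then have "of_int u * A \<le> 0" using AB by (simp add: mult_nonpos_nonneg)
    then have "of_int v * B < 0" using uv(3) pos by linarith
    then have "v \<le> -1" using AB by (simp add: mult_less_0_iff)
    then have "v * int t \<le> - int t" using mult_right_mono[of v "-1" "int t"] by simp
    moreover have "u * int n \<le> 0" using u by (simp add: mult_nonpos_nonneg)
    ultimately have "N = 0" "t = 0" using uv(1) by linarith+
    with N have "n = 0" by simp
    with \<open>t = 0\<close> show False using U by (simp add: unimod_def)
  qed
  have un: "u * int n \<ge> int n" using u mult_right_mono[of 1 u "int n"] by simp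
  have "v \<ge> 0"
  proof (rule ccontr)
    assume "\<not> v \<ge> 0"
    then have "of_int v * B \<le> - B" using mult_le_self_neg AB by simp
    moreover have "of_int u * A \<ge> A" using u AB by simp
    ultimately have "real N * \<beta> - of_int C \<ge> A + B" using uv(3) by linarith
    moreover obtain j where "j \<le> N" "frac (y + real j * \<beta>) \<ge> 1 - (A + B)"
      using three_gap_bound[OF U N] unfolding A_def B_def by blast
    moreover have "\<forall>j\<le>N. frac (y + real j * \<beta>) < 1 - (real N * \<beta> - of_int C)"
      using floor_period_iff_frac[of N \<beta> C y N] P pos by simp
    ultimately show False by fastforce
  qed
  moreover have "\<not> v \<ge> 1"
  proof
    assume "v \<ge> 1"
    then have "v * int t \<ge> int t" using mult_right_mono[of 1 v "int t"] by simp
    then show False using un uv(1) N(3) by linarith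
  qed
  ultimately have "v = 0" by simp
  then have "N = nat u * n" "C = int (nat u) * c"
    using uv u by (auto simp flip: nat_mult_distrib) (metis nat_int nat_mult_distrib zero_le_one order_trans)
  then show ?thesis using that by blast
qed

text \<open>Up to time \<open>e * s\<close> the orbit avoids the final arc of length
  \<open>e * A\<close>. Every further block of \<open>s\<close> steps raises fractional parts by at
  most \<open>A\<close>, so after \<open>e - 1\<close> blocks an arc of length \<open>A\<close> is
  still avoided. Thus the square of an \<open>e\<close>-th power is seen as a \<open>2e\<close>-th
  power.\<close>

lemma period_root:
  assumes P: "floor_period \<beta> (e * s) (int e * c) y (e * s)" and e: "e \<ge> 1" and pos: "of_int c < real s * \<beta>"
  shows "floor_period \<beta> s c y ((2 * e - 1) * s)"
proof -
  define A where "A = real s * \<beta> - of_int c"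
  have A: "A > 0" using pos by (simp add: A_def)
  have th: "real (e * s) * \<beta> - of_int (int e * c) = real e * A" by (simp add: A_def algebra_simps)
  have P': "frac (y + real j * \<beta>) < 1 - real e * A" if "j \<le> e * s" for j
    using floor_period_iff_frac[of "e * s" \<beta> "int e * c" y "e * s"] P A that unfolding th by simp
  have "\<forall>j \<le> (e + i) * s. frac (y + real j * \<beta>) < 1 - (real e - real i) * A" if "i < e" for i
    using that
  proof (induction i)
    case (Suc i)
    show ?case
    proof (intro allI impI)
      fix j assume j: "j \<le> (e + Suc i) * s"
      show "frac (y + real j * \<beta>) < 1 - (real e - real (Suc i)) * A"
      proof (cases "j \<le> (e + i) * s")
        case True
        then have "frac (y + real j * \<beta>) < 1 - (real e - real i) * A" using Suc by simp
        then show ?thesis using A by (simp add: algebra_simps)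
      next
        case False
        then have "s \<le> j" using Suc.prems by (cases e) auto
        then have ij: "real j = real (j - s) + real s" by simp
        have "j - s \<le> (e + i) * s" using j by simp
        then have f: "frac (y + real (j - s) * \<beta>) < 1 - (real e - real i) * A" using Suc by simp
        have "y + real j * \<beta> = (y + real (j - s) * \<beta> + A) + of_int c"
          unfolding ij by (simp add: A_def algebra_simps)
        then have "frac (y + real j * \<beta>) = frac (y + real (j - s) * \<beta> + A)"
          by (simp only: frac_add_of_int_right)
        also have "\<dots> \<le> frac (y + real (j - s) * \<beta>) + A"
          using A floor_mono[of "y + real (j - s) * \<beta>" "y + real (j - s) * \<beta> + A"]
          unfolding frac_def by linarith
        finally show ?thesis using f by (simp add: algebra_simps)
      qed
    qed
  qed (use P' in simp)
  from this[of "e - 1"] e have "\<forall>j \<le> (2 * e - 1) * s. frac (y + real j * \<beta>) < 1 - A"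
    by (simp add: of_nat_diff mult_2)
  then show ?thesis using floor_period_iff_frac[of s \<beta> c y] A unfolding A_def by simp
qed

lemma period_code_sum:
  assumes "\<bar>\<beta>\<bar> < 1" "floor_period \<beta> n c y M"
  shows "c = (if \<beta> \<ge> 0 then 1 else -1) * int (sum_list (code \<beta> y n))"
proof -
  have "\<lfloor>y + real n * \<beta>\<rfloor> = \<lfloor>y\<rfloor> + c" using floor_period_D[OF assms(2), of 0] by simp
  then show ?thesis using floor_code_sum[OF assms(1), of y n] by linarith
qed

lemma word_pow_in_codesD:
  assumes "word_pow w p \<in> codes \<beta>"
  obtains y where "code \<beta> y (p * length w) = word_pow w p"
proof -
  obtain y N where yN: "word_pow w p = code \<beta> y N" using assms by (auto simp: codes_def)
  from arg_cong[OF this, of length] have "N = p * length w" by simp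
  then show ?thesis using that yN by simp
qed

text \<open>A power found at an arbitrary \<open>y\<close> also belongs to some
  \<open>-m'\<beta>\<close> satisfying the bound; orbit words are distinct, so
  \<open>m' = m\<close>.\<close>

lemma orbit_word_pow_iff:
  assumes U: "unimod \<beta> n c t d" and less: "of_int d - real t * \<beta> < real n * \<beta> - of_int c"
    and b: "\<beta> \<notin> \<rat>" "\<bar>\<beta>\<bar> < 1" and mt: "m < n" "t > 0" and p: "p \<ge> 1"
  shows "word_pow (orbit_word \<beta> n m) p \<in> codes \<beta> \<longleftrightarrow> (p - 1) * n < m + t"
proof
  assume "(p - 1) * n < m + t"
  from floor_period_word_pow[OF unimod_period[OF U mt(1) this] p]
  show "word_pow (orbit_word \<beta> n m) p \<in> codes \<beta>" by (metis code_in_codes orbit_word_def)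
next
  assume L: "word_pow (orbit_word \<beta> n m) p \<in> codes \<beta>"
  show "(p - 1) * n < m + t"
  proof (cases "p = 1")
    case False
    then have p2: "n \<le> (p - 1) * n" using p by (cases "p - 1") auto
    obtain y where y: "code \<beta> y (p * n) = word_pow (orbit_word \<beta> n m) p"
      using word_pow_in_codesD[OF L] by auto
    \<comment> \<open>The trivial period at the orbit point itself identifies \<open>c\<close> with
      the signed letter sum of the word, so the period found at \<open>y\<close> has the same
      \<open>c\<close>.\<close>
    have "floor_period \<beta> n c (- (real m * \<beta>)) 0" using unimod_period[OF U mt(1), of 0] mt by simp
    from period_code_sum[OF b(2) this] word_pow_floor_period[OF b(2) y _ p]
    have "floor_period \<beta> n c y ((p - 1) * n)" and w: "code \<beta> y n = orbit_word \<beta> n m"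
      by (auto simp: orbit_word_def)
    from unimod_period_orbit[OF U less this(1) p2]
    obtain m' where m': "m' < n" "(p - 1) * n < m' + t" "code \<beta> y n = orbit_word \<beta> n m'" by blast
    then show ?thesis using orbit_word_inj[OF b, of m n m'] w mt(1) by simp
  qed (use mt in simp)
qed

subsection \<open>Index and cyclic shift\<close>

lemma mult_le_add_iff: "i < N \<Longrightarrow> x * N \<le> y * N + i \<longleftrightarrow> x \<le> y" for i N x y :: nat
proof
  assume "i < N" "x * N \<le> y * N + i"
  then have "x * N < Suc y * N" by simp
  then show "x \<le> y" unfolding mult_less_cancel2 by simp
next
  assume "x \<le> y"
  then have "x * N \<le> y * N" by (rule mult_le_mono1)
  then show "x * N \<le> y * N + i" by linarith
qed

lemma index_eqI:
  assumes "\<And>p. p \<ge> 1 \<Longrightarrow> word_pow w p \<in> L \<longleftrightarrow> p \<le> K"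
  shows "index L w = enat K"
proof (cases "K = 0")
  case True
  then have S: "{enat p | p. p \<ge> 1 \<and> word_pow w p \<in> L} = {}" using assms by auto
  show ?thesis unfolding index_def S using True by (simp add: bot_enat_def zero_enat_def)
next
  case False
  then show ?thesis unfolding index_def using assms
    by (intro antisym Sup_least Sup_upper) auto
qed

lemma index_word_powI:
  assumes "\<And>p. p \<ge> 1 \<Longrightarrow> word_pow w p \<in> L \<longleftrightarrow> p \<le> K" "m \<ge> 1"
  shows "index L (word_pow w m) = enat (K div m)"
proof (rule index_eqI)
  fix p :: nat assume "p \<ge> 1"
  then show "word_pow (word_pow w m) p \<in> L \<longleftrightarrow> p \<le> K div m"
    using assms by (simp add: word_pow_mult less_eq_div_iff_mult_less_eq mult.commute)
qed

lemma index_codes_1: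
  assumes "w \<in> codes \<beta>" "word_pow w 2 \<notin> codes \<beta>"
  shows "index (codes \<beta>) w = 1"
proof -
  have "index (codes \<beta>) w = enat 1"
  proof (rule index_eqI)
    fix p :: nat assume p: "p \<ge> 1"
    show "word_pow w p \<in> codes \<beta> \<longleftrightarrow> p \<le> 1"
    proof
      assume "word_pow w p \<in> codes \<beta>"
      then show "p \<le> 1" using assms(2) word_pow_codes_mono[of w p \<beta> 2] by linarith
    next
      assume "p \<le> 1"
      then have "p = 1" using p by simp
      then show "word_pow w p \<in> codes \<beta>" using assms(1) by simp
    qed
  qed
  then show ?thesis by (simp add: one_enat_def)
qed

lemma cshift_snoc [simp]: "cshift (u @ [z]) = z # u"
  by (simp add: cshift_def)

lemma cshift_word_pow: "cshift (word_pow w m) = word_pow (cshift w) m"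
proof (cases "w = [] \<or> m = 0")
  case True
  then show ?thesis by (auto simp: cshift_def word_pow_def)
next
  case False
  then obtain u z r where w: "w = u @ [z]" and m: "m = Suc r"
    by (metis append_butlast_last_id not0_implies_Suc)
  \<comment> \<open>This is \<open>(uz)^r u = u (zu)^r\<close>, with the letter \<open>z\<close>
    that will be moved kept at the end.\<close>
  have "word_pow (u @ [z]) r @ u @ [z] = u @ word_pow (z # u) r @ [z]" for r
    by (induction r) auto
  then show ?thesis
    unfolding w m word_pow_Suc_right by (metis append.assoc cshift_snoc append_Cons word_pow_Suc word_pow_Suc_right)
qed

lemma funpow_cshift_word_pow: "(cshift ^^ i) (word_pow w m) = word_pow ((cshift ^^ i) w) m"
  by (induction i) (auto simp: cshift_word_pow)

lemma code_Suc: "code \<beta> y (Suc r) = code \<beta> y r @ [nat \<bar>\<lfloor>y + real (Suc r) * \<beta>\<rfloor> - \<lfloor>y + real r * \<beta>\<rfloor>\<bar>]"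
  by (simp add: code_def)

lemma code_Suc_left: "code \<beta> (y - \<beta>) (Suc r) = nat \<bar>\<lfloor>y\<rfloor> - \<lfloor>y - \<beta>\<rfloor>\<bar> # code \<beta> y r"
  using code_append[of \<beta> "y - \<beta>" 1 r] by (simp add: code_def)

text \<open>The shifted word starts one step earlier, and period \<open>n\<close> makes its first
  letter the old last letter. At \<open>m = n - 1\<close> the period allows the start to be replaced
  by \<open>\<beta>\<close>, one step before which lies 0.\<close>

lemma cshift_orbit_word:
  assumes U: "unimod \<beta> n c t d" and m: "m < n" and t: "t > 0"
  shows "cshift (orbit_word \<beta> n m) = orbit_word \<beta> n (Suc m mod n)"
proof -
  obtain r where n: "n = Suc r" using m by (cases n) auto
  define y where "y = - (real m * \<beta>)"
  show ?thesis
  proof (cases "Suc m < n")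
    case True
    have y': "- (real (Suc m) * \<beta>) = y - \<beta>" by (simp add: y_def algebra_simps)
    have "floor_period \<beta> n c (y - \<beta>) 1"
      using unimod_period[OF U True, of 1] t unfolding y' by simp
    from floor_period_D[OF this, of 0] floor_period_D[OF this, of 1]
    have "\<lfloor>y - \<beta> + real n * \<beta>\<rfloor> = \<lfloor>y - \<beta>\<rfloor> + c" "\<lfloor>y - \<beta> + real (Suc n) * \<beta>\<rfloor> = \<lfloor>y\<rfloor> + c" by simp_all
    moreover have "y - \<beta> + real n * \<beta> = y + real r * \<beta>" "y - \<beta> + real (Suc n) * \<beta> = y + real (Suc r) * \<beta>"
      unfolding n by (simp_all add: algebra_simps)
    ultimately have "\<lfloor>y + real (Suc r) * \<beta>\<rfloor> - \<lfloor>y + real r * \<beta>\<rfloor> = \<lfloor>y\<rfloor> - \<lfloor>y - \<beta>\<rfloor>"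
      by (simp only:)
    then have "cshift (code \<beta> y (Suc r)) = code \<beta> (y - \<beta>) (Suc r)"
      unfolding code_Suc_left by (simp only: code_Suc cshift_snoc)
    then show ?thesis using True unfolding orbit_word_def n by (simp add: y_def y'[unfolded y_def] del: of_nat_Suc)
  next
    case False
    then have mr: "m = r" using m n by simp
    have P: "floor_period \<beta> n c y r"
      using unimod_period[OF U m, of r] t unfolding y_def mr by simp
    have "code \<beta> \<beta> r = code \<beta> y r"
    proof (rule code_cong)
      fix j assume "j \<le> r"
      from floor_period_D[OF P this] show "\<lfloor>\<beta> + real j * \<beta>\<rfloor> = \<lfloor>y + real j * \<beta>\<rfloor> + c"
        by (simp add: y_def mr n algebra_simps)
    qed
    moreover have "y + real (Suc r) * \<beta> = \<beta>" "y + real r * \<beta> = 0" by (simp_all add: y_def mr algebra_simps)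
    ultimately have "cshift (code \<beta> y (Suc r)) = code \<beta> (\<beta> - \<beta>) (Suc r)"
      unfolding code_Suc_left by (simp add: code_Suc del: of_nat_Suc)
    then show ?thesis unfolding orbit_word_def n mr by (simp add: y_def mr)
  qed
qed

lemma funpow_cshift_orbit_word:
  assumes U: "unimod \<beta> n c t d" and m: "m < n" and t: "t > 0"
  shows "(cshift ^^ i) (orbit_word \<beta> n m) = orbit_word \<beta> n ((m + i) mod n)"
proof (induction i)
  case (Suc i)
  then show ?case using cshift_orbit_word[OF U _ t, of "(m + i) mod n"] m by (simp add: mod_Suc_eq)
qed (use m in simp)

section \<open>Mirror images and reversal\<close>

lemma floor_uminus_mult:
  fixes \<beta> :: real
  assumes "\<beta> \<notin> \<rat>" "i > (0::nat)"
  shows "\<lfloor>- (real i * \<beta>)\<rfloor> = - \<lfloor>real i * \<beta>\<rfloor> - 1"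
proof -
  have "real_of_int \<lfloor>real i * \<beta>\<rfloor> \<noteq> real i * \<beta>"
    using rational_mult_int[OF assms(1), of "int i" "\<lfloor>real i * \<beta>\<rfloor>"] assms(2) by auto
  then show ?thesis by linarith
qed

text \<open>Only multiples \<open>i\<beta>\<close> with \<open>i > 0\<close> occur, and none is an
  integer, so floors and ceilings read the same letters. Standard words can therefore be studied
  with either sign.\<close>

lemma code_uminus_self:
  assumes "\<beta> \<notin> \<rat>"
  shows "code (- \<beta>) (- \<beta>) n = code \<beta> \<beta> n"
proof (rule nth_equalityI)
  fix j assume "j < length (code (- \<beta>) (- \<beta>) n)"
  moreover have "- \<beta> + real i * - \<beta> = - (real (Suc i) * \<beta>)" "\<beta> + real i * \<beta> = real (Suc i) * \<beta>" for i
    by (simp_all add: algebra_simps)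
  ultimately show "code (- \<beta>) (- \<beta>) n ! j = code \<beta> \<beta> n ! j"
    using floor_uminus_mult[OF assms] by (simp add: nth_code del: of_nat_Suc mult_minus_right)
qed simp

text \<open>Reading backwards replaces \<open>i\<beta>\<close> by \<open>-i\<beta>\<close>; adding
  \<open>t\<beta>\<close> changes all these floors by \<open>d\<close> and leads to the orbit of
  \<open>-(n - t + 1)\<beta>\<close>. The largest multiple is \<open>n + 1\<close>, and
  \<open>n + 1 < n + t\<close> is where \<open>t \<ge> 2\<close> enters.\<close>

lemma rev_code_self:
  assumes U: "unimod \<beta> n c t d" and b: "\<beta> \<notin> \<rat>" and t: "2 \<le> t" "t \<le> n"
  shows "rev (code \<beta> \<beta> n) = orbit_word \<beta> n (n - t + 1)"
proof (rule nth_equalityI)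
  fix j assume "j < length (rev (code \<beta> \<beta> n))"
  then have j: "j < n" by simp
  define i where "i = n - j"
  have i: "0 < i" "i \<le> n" "j + i = n" using j by (auto simp: i_def)
  have e1: "- (real (n - t + 1) * \<beta>) + real (Suc j) * \<beta> = of_int (- int i + int t) * \<beta>"
    and e0: "- (real (n - t + 1) * \<beta>) + real j * \<beta> = of_int (- int (Suc i) + int t) * \<beta>"
    using t i(3)[symmetric] by (simp_all add: of_nat_diff algebra_simps)
  have f1: "\<lfloor>of_int (- int i + int t) * \<beta>\<rfloor> = - \<lfloor>real i * \<beta>\<rfloor> - 1 + d"
    and f0: "\<lfloor>of_int (- int (Suc i) + int t) * \<beta>\<rfloor> = - \<lfloor>real (Suc i) * \<beta>\<rfloor> - 1 + d"
    using unimod_floor_add_below[OF U, of "- int i"] unimod_floor_add_below[OF U, of "- int (Suc i)"]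
      floor_uminus_mult[OF b, of i] floor_uminus_mult[OF b, of "Suc i"] i t
    by (simp_all add: algebra_simps)
  have o: "orbit_word \<beta> n (n - t + 1) ! j = nat \<bar>\<lfloor>real (Suc i) * \<beta>\<rfloor> - \<lfloor>real i * \<beta>\<rfloor>\<bar>"
    unfolding orbit_word_def nth_code[OF j] e1 e0 f1 f0 by (rule arg_cong[where f = nat]) linarith
  have "rev (code \<beta> \<beta> n) ! j = code \<beta> \<beta> n ! (i - 1)" using j by (simp add: rev_nth i_def)
  also have "\<dots> = nat \<bar>\<lfloor>\<beta> + real (Suc (i - 1)) * \<beta>\<rfloor> - \<lfloor>\<beta> + real (i - 1) * \<beta>\<rfloor>\<bar>"
    using i by (intro nth_code) auto
  also have "\<beta> + real (Suc (i - 1)) * \<beta> = real (Suc i) * \<beta>"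
    using i(1) by (simp add: of_nat_diff algebra_simps)
  also have "\<beta> + real (i - 1) * \<beta> = real i * \<beta>"
    using i(1) by (simp add: of_nat_diff algebra_simps)
  finally show "rev (code \<beta> \<beta> n) ! j = orbit_word \<beta> n (n - t + 1) ! j" using o by simp
qed simp

subsection \<open>Continued fraction expansions\<close>

text \<open>The index is shifted by one against the usual convention, so that the recursions start at the
  conventional index \<open>-1\<close>: \<open>cden a (k + 1) = q\<^sub>k\<close>, \<open>cnum a (k + 1) = p\<^sub>k\<close> and
  \<open>cerr \<alpha> a (k + 1) = \<bar>q\<^sub>k \<alpha> - p\<^sub>k\<bar>\<close>.\<close>

fun cden :: "(nat \<Rightarrow> nat) \<Rightarrow> nat \<Rightarrow> nat" where
  "cden a 0 = 0"
| "cden a (Suc 0) = 1"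
| "cden a (Suc (Suc k)) = a (Suc k) * cden a (Suc k) + cden a k"

fun cnum :: "(nat \<Rightarrow> nat) \<Rightarrow> nat \<Rightarrow> nat" where
  "cnum a 0 = 1"
| "cnum a (Suc 0) = 0"
| "cnum a (Suc (Suc k)) = a (Suc k) * cnum a (Suc k) + cnum a k"

fun cerr :: "real \<Rightarrow> (nat \<Rightarrow> nat) \<Rightarrow> nat \<Rightarrow> real" where
  "cerr \<alpha> a 0 = 1"
| "cerr \<alpha> a (Suc 0) = \<alpha>"
| "cerr \<alpha> a (Suc (Suc k)) = cerr \<alpha> a k - real (a (Suc k)) * cerr \<alpha> a (Suc k)"

lemma cden_Suc: "cden a (Suc k) = q a k"
  by (induction a k rule: q.induct) auto

lemma cfrac_bounds: "\<forall>b \<in> set bs. b \<ge> 1 \<Longrightarrow> 0 \<le> cfrac bs \<and> cfrac bs \<le> 1"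
proof (induction bs)
  case (Cons b bs)
  then have "0 \<le> cfrac bs" "b \<ge> 1" by auto
  then have "1 \<le> real b + cfrac bs" by linarith
  then show ?case by simp
qed simp

text \<open>One step of the Gauss map: inverting the convergents of \<open>x\<close> and subtracting
  \<open>a 1\<close> gives the convergents of the tail, and irrationality turns the weak bounds of
  the limit into strict ones.\<close>

lemma has_cfrac_step:
  assumes x: "x \<notin> \<rat>" and H: "has_cfrac x a"
  defines "x' \<equiv> 1 / x - real (a 1)"
  shows "has_cfrac x' (\<lambda>i. a (Suc i))" "x' \<notin> \<rat>" "0 < x'" "x' < 1"
proof -
  define X where "X n = cfrac (map a [1..<Suc n])" for n
  define Y where "Y n = cfrac (map (\<lambda>i. a (Suc i)) [1..<Suc n])" for n
  have a: "a i \<ge> 1" if "i \<ge> 1" for i using H that by (auto simp: has_cfrac_def)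
  have Y: "0 \<le> Y n" "Y n \<le> 1" for n
    using cfrac_bounds[of "map (\<lambda>i. a (Suc i)) [1..<Suc n]"] a by (auto simp: Y_def)
  have "[1..<Suc (Suc n)] = 1 # map Suc [1..<Suc n]" for n
    by (simp add: upt_conv_Cons map_Suc_upt del: upt_Suc)
  then have XY: "X (Suc n) = 1 / (real (a 1) + Y n)" for n
    by (simp add: X_def Y_def o_def del: upt_Suc)
  have Y_eq: "Y = (\<lambda>n. 1 / X (Suc n) - real (a 1))" using XY by (simp add: fun_eq_iff)
  have X_lim: "(\<lambda>n. X (Suc n)) \<longlonglongrightarrow> x" using H LIMSEQ_Suc unfolding has_cfrac_def X_def by blast
  have "x \<noteq> 0" using x by auto
  then have lim: "Y \<longlonglongrightarrow> x'" unfolding x'_def Y_eq by (intro tendsto_intros X_lim)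
  then show "has_cfrac x' (\<lambda>i. a (Suc i))" using a unfolding has_cfrac_def Y_def by auto
  have b: "0 \<le> x'" "x' \<le> 1"
    using LIMSEQ_le_const[OF lim, of 0] LIMSEQ_le_const2[OF lim, of 1] Y by blast+
  show r: "x' \<notin> \<rat>"
  proof
    assume "x' \<in> \<rat>"
    then have "inverse (x' + real (a 1)) \<in> \<rat>" by simp
    then show False using x by (simp add: x'_def)
  qed
  show "0 < x'" "x' < 1" using b r by (auto simp: order_le_less)
qed

locale cf_expansion =
  fixes \<alpha> :: real and a :: "nat \<Rightarrow> nat"
  assumes alpha: "0 < \<alpha>" "\<alpha> < 1" "\<alpha> \<notin> \<rat>" and cf: "has_cfrac \<alpha> a" and a1: "a 1 \<ge> 2"
begin

abbreviation "Q \<equiv> cden a"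
abbreviation "E \<equiv> cerr \<alpha> a"

text \<open>The alternating sign makes \<open>Q (Suc k)\<close> approximate from above and
  \<open>Q k\<close> from below for every \<open>k\<close>, so one-sided lemmas apply without a
  parity split.\<close>

definition \<beta> :: "nat \<Rightarrow> real" where "\<beta> k = (-1) ^ k * \<alpha>"
definition c :: "nat \<Rightarrow> nat \<Rightarrow> int" where "c k j = (-1) ^ k * int (cnum a j)"

lemma a_pos: "i \<ge> 1 \<Longrightarrow> a i \<ge> 1"
  using cf by (simp add: has_cfrac_def)

text \<open>The ratio \<open>E (Suc k) / E k\<close> is the \<open>k\<close>-th iterate of
  \<open>\<alpha>\<close> under the Gauss map, expanded by a tail of \<open>a\<close>; it stays in
  the open unit interval.\<close>

lemma cerr_pos_less: "E k > 0 \<and> E (Suc k) > 0 \<and> E (Suc k) < E k"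
proof -
  have "E k > 0 \<and> has_cfrac (E (Suc k) / E k) (\<lambda>i. a (i + k)) \<and> E (Suc k) / E k \<notin> \<rat> \<and>
      0 < E (Suc k) / E k \<and> E (Suc k) / E k < 1"
  proof (induction k)
    case 0
    then show ?case using alpha cf by simp
  next
    case (Suc k)
    then have pos: "E k > 0" "E (Suc k) > 0" by (auto simp: zero_less_divide_iff)
    have "1 / (E (Suc k) / E k) - real (a (1 + k)) = E (Suc (Suc k)) / E (Suc k)"
      using pos by (simp add: diff_divide_distrib)
    then show ?case
      using has_cfrac_step[of "E (Suc k) / E k" "\<lambda>i. a (i + k)"] Suc pos by auto
  qed
  then show ?thesis by (auto simp: zero_less_divide_iff)
qed

lemma beta_irrational: "\<beta> k \<notin> \<rat>"
proof
  assume "\<beta> k \<in> \<rat>"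
  then have "(-1) ^ k * \<beta> k \<in> \<rat>" by (intro Rats_mult Rats_power) auto
  then show False using alpha by (simp add: \<beta>_def flip: power_mult_distrib mult.assoc)
qed

lemma abs_beta: "\<bar>\<beta> k\<bar> < 1"
  using alpha by (simp add: \<beta>_def abs_mult)

lemma beta_cases: "\<beta> k = \<alpha> \<or> \<beta> k = - \<alpha>"
  by (cases "even k") (auto simp: \<beta>_def)

lemma beta_Suc: "\<beta> (Suc k) = - \<beta> k"
  by (simp add: \<beta>_def)

lemma codes_beta: "codes (\<beta> k) = codes \<alpha>"
  using beta_cases[of k] codes_uminus by auto

lemma code_beta_self: "code (\<beta> k) (\<beta> k) n = code \<alpha> \<alpha> n"
  using beta_cases[of k] code_uminus_self[OF alpha(3)] by auto

lemma cden_error: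
  "real (Q k) * \<beta> k - of_int (c k k) = - E k"
  "real (Q (Suc k)) * \<beta> k - of_int (c k (Suc k)) = E (Suc k)"
proof -
  have "real (Q k) * \<alpha> - real (cnum a k) = - ((-1) ^ k * E k) \<and>
     real (Q (Suc k)) * \<alpha> - real (cnum a (Suc k)) = (-1) ^ k * E (Suc k)"
  proof (induction k)
    case (Suc k)
    have "real (Q (Suc (Suc k))) * \<alpha> - real (cnum a (Suc (Suc k)))
        = real (a (Suc k)) * (real (Q (Suc k)) * \<alpha> - real (cnum a (Suc k))) + (real (Q k) * \<alpha> - real (cnum a k))"
      by (simp add: algebra_simps)
    also have "\<dots> = (-1) ^ Suc k * E (Suc (Suc k))" using Suc by (simp add: algebra_simps)
    finally show ?case using Suc by simp
  qed simp
  moreover have "(-1) ^ k * ((-1) ^ k * x) = x" for x :: real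
    by (simp flip: power_mult_distrib mult.assoc)
  moreover have "real (Q j) * \<beta> k - of_int (c k j) = (-1) ^ k * (real (Q j) * \<alpha> - real (cnum a j))" for j
    by (simp add: \<beta>_def c_def algebra_simps)
  ultimately show
    "real (Q k) * \<beta> k - of_int (c k k) = - E k"
    "real (Q (Suc k)) * \<beta> k - of_int (c k (Suc k)) = E (Suc k)" by simp_all
qed

lemma c_Suc_left: "c (Suc k) j = - c k j"
  by (simp add: c_def)

lemma c_Suc_Suc: "c k (Suc (Suc j)) = c k j + int (a (Suc j)) * c k (Suc j)"
  by (simp add: c_def algebra_simps)

lemma error_semi:
  "of_int (c k k + int l * c k (Suc k)) - real (Q k + l * Q (Suc k)) * \<beta> k = E k - real l * E (Suc k)"
  using cden_error[of k] by (simp add: algebra_simps)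

lemma error_semi_pos:
  assumes "l \<le> a (Suc k)"
  shows "E k - real l * E (Suc k) > 0"
    and "l < a (Suc k) \<Longrightarrow> E (Suc k) < E k - real l * E (Suc k)"
proof -
  have 1: "E k - real (a (Suc k)) * E (Suc k) > 0" "E (Suc k) > 0"
    using cerr_pos_less[of "Suc k"] by auto
  have "real l * E (Suc k) \<le> real (a (Suc k)) * E (Suc k)"
    using 1 assms by (intro mult_right_mono) auto
  then show "E k - real l * E (Suc k) > 0" using 1 by linarith
  assume "l < a (Suc k)"
  then have "real (Suc l) * E (Suc k) \<le> real (a (Suc k)) * E (Suc k)"
    using 1 by (intro mult_right_mono) auto
  then show "E (Suc k) < E k - real l * E (Suc k)" using 1 by (simp add: algebra_simps)
qed

text \<open>Adding \<open>a (Suc k)\<close> copies of the first vector to the second and then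
  mirroring yields the pair of the next two convergents.\<close>

lemma unimod_base: "unimod (\<beta> k) (Q (Suc k)) (c k (Suc k)) (Q k) (c k k)"
proof (induction k)
  case 0
  then show ?case using alpha by (simp add: unimod_def \<beta>_def c_def)
next
  case (Suc k)
  have "real (Q k + a (Suc k) * Q (Suc k)) * \<beta> k < of_int (c k k + int (a (Suc k)) * c k (Suc k))"
    using error_semi[of k "a (Suc k)"] error_semi_pos[of "a (Suc k)" k] by linarith
  from unimod_swap[OF unimod_add[OF Suc this]]
  show ?case by (simp add: beta_Suc c_Suc_left c_Suc_Suc add.commute)
qed

lemma unimod_semi:
  assumes "l \<le> a (Suc k)"
  shows "unimod (\<beta> (Suc k)) (Q k + l * Q (Suc k)) (c (Suc k) k + int l * c (Suc k) (Suc k))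
    (Q (Suc k)) (c (Suc k) (Suc k))"
proof -
  have "real (Q k + l * Q (Suc k)) * \<beta> k < of_int (c k k + int l * c k (Suc k))"
    using error_semi[of k l] error_semi_pos(1)[OF assms] by linarith
  from unimod_swap[OF unimod_add[OF unimod_base this]]
  show ?thesis by (simp add: beta_Suc c_Suc_left)
qed

lemma unimod_conv: "unimod (\<beta> k) (Q (Suc k)) (c k (Suc k)) (Q (Suc (Suc k))) (c k (Suc (Suc k)))"
  using unimod_swap[OF unimod_base[of "Suc k"]] by (simp add: beta_Suc c_Suc_left)

text \<open>With \<open>l < a (Suc k)\<close> at least one more \<open>E (Suc k)\<close> fits into
  the error. For \<open>l = a (Suc k)\<close> the fraction is the next convergent and the comparison
  reverses; its partner is then the following convergent, as in \<open>unimod_conv\<close>.\<close>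

lemma less_semi:
  assumes "l < a (Suc k)"
  shows "of_int (c (Suc k) (Suc k)) - real (Q (Suc k)) * \<beta> (Suc k)
    < real (Q k + l * Q (Suc k)) * \<beta> (Suc k) - of_int (c (Suc k) k + int l * c (Suc k) (Suc k))"
  using error_semi_pos(2)[of l k] assms error_semi[of k l] cden_error(2)[of k]
  by (simp add: beta_Suc c_Suc_left)

lemma less_conv:
  "of_int (c k (Suc (Suc k))) - real (Q (Suc (Suc k))) * \<beta> k < real (Q (Suc k)) * \<beta> k - of_int (c k (Suc k))"
  using cden_error(2)[of "Suc k"] cden_error(2)[of k] cerr_pos_less[of "Suc k"]
  by (simp add: beta_Suc c_Suc_left del: cden.simps cerr.simps)

lemma cden_pos: "Q (Suc k) \<ge> 1"
proof (induction k)
  case (Suc k)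
  then have "1 * 1 \<le> a (Suc k) * Q (Suc k)" using a_pos[of "Suc k"] by (intro mult_le_mono) auto
  then show ?case unfolding cden.simps(3) by linarith
qed simp

declare cden.simps(3) [simp del]

lemma cden_less: "k \<ge> 1 \<Longrightarrow> Q k < Q (Suc k)"
proof (induction k rule: dec_induct)
  case base
  then show ?case using a1 by (simp add: cden.simps(3))
next
  case (step k)
  have "1 * Q (Suc k) \<le> a (Suc k) * Q (Suc k)" using a_pos[of "Suc k"] by (intro mult_le_mono) auto
  moreover have "Q k \<ge> 1" using cden_pos[of "k - 1"] step by simp
  ultimately show ?case unfolding cden.simps(3) by linarith
qed

lemma cden_mono:
  assumes "1 \<le> i" "i \<le> j"
  shows "Q i \<le> Q j"
  using assms(2)
proof (induction j rule: dec_induct)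
  case (step j)
  then show ?case using cden_less[of j] assms(1) by simp
qed simp

lemma cden_ge_2: "k \<ge> 2 \<Longrightarrow> Q k \<ge> 2"
  using cden_mono[of 2 k] a1 by (simp add: numeral_2_eq_2 cden.simps(3))

lemma cden_bracket_unique:
  assumes "1 \<le> i" "1 \<le> j" "Q i \<le> n" "n < Q (Suc i)" "Q j \<le> n" "n < Q (Suc j)"
  shows "i = j"
  using cden_mono[of "Suc i" j] cden_mono[of "Suc j" i] assms by (metis Suc_leI le_trans linorder_neqE_nat not_le le_SucI)

lemma conv_pow_iff:
  assumes "m < Q (Suc k)" "p \<ge> 1"
  shows "word_pow (orbit_word (\<beta> k) (Q (Suc k)) m) p \<in> codes \<alpha> \<longleftrightarrow> (p - 1) * Q (Suc k) < m + Q (Suc (Suc k))"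
  using orbit_word_pow_iff[OF unimod_conv less_conv beta_irrational abs_beta assms(1) _ assms(2)]
    cden_pos[of "Suc k"] by (simp add: codes_beta)

lemma semi_pow_iff:
  assumes "l < a (Suc k)" "m < Q k + l * Q (Suc k)" "p \<ge> 1"
  shows "word_pow (orbit_word (\<beta> (Suc k)) (Q k + l * Q (Suc k)) m) p \<in> codes \<alpha>
    \<longleftrightarrow> (p - 1) * (Q k + l * Q (Suc k)) < m + Q (Suc k)"
  using orbit_word_pow_iff[OF unimod_semi less_semi beta_irrational abs_beta assms(2) _ assms(3)]
    cden_pos[of k] assms(1) by (simp add: codes_beta)

lemma semi_bracket:
  assumes "n \<ge> 1"
  obtains k l where "1 \<le> l" "l \<le> a (Suc k)" "Q k + l * Q (Suc k) \<le> n" "n < Q k + Suc l * Q (Suc k)"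
proof -
  \<comment> \<open>The intervals from \<open>Q k + Q (Suc k)\<close> up to
    \<open>Q (Suc k) + Q (Suc (Suc k))\<close> cover all \<open>n \<ge> 1\<close>, starting at
    \<open>Q 0 + Q 1 = 1\<close>. Inside one of them, \<open>l\<close> comes from division by
    \<open>Q (Suc k)\<close>.\<close>
  define k where "k = (LEAST k. n < Q (Suc k) + Q (Suc (Suc k)))"
  have le: "k \<le> Q (Suc k)" for k
  proof (induction k)
    case (Suc k)
    then show ?case using cden_less[of "Suc k"] by simp
  qed simp
  have ex: "\<exists>k. n < Q (Suc k) + Q (Suc (Suc k))"
    using le[of n] cden_pos[of "Suc n"] by (intro exI[of _ n]) linarith
  have 1: "n < Q (Suc k) + Q (Suc (Suc k))" unfolding k_def by (rule LeastI_ex[OF ex])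
  have 2: "Q k + Q (Suc k) \<le> n"
  proof (cases k)
    case 0
    then show ?thesis using assms by simp
  next
    case (Suc j)
    then show ?thesis using not_less_Least[of j "\<lambda>k. n < Q (Suc k) + Q (Suc (Suc k))"] k_def by simp
  qed
  define l where "l = (n - Q k) div Q (Suc k)"
  have q: "Q (Suc k) > 0" using cden_pos[of k] by simp
  have l1: "1 \<le> l" using 2 q by (simp add: l_def Suc_le_eq div_greater_zero_iff)
  have l2: "l * Q (Suc k) \<le> n - Q k" "n - Q k < Suc l * Q (Suc k)"
    using q by (auto simp: l_def dividend_less_div_times div_times_less_eq_dividend)
  have "l * Q (Suc k) < Suc (a (Suc k)) * Q (Suc k)" using l2 1 2 by (simp add: cden.simps(3))
  then have "l \<le> a (Suc k)" unfolding mult_less_cancel2 by simp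
  then show ?thesis using that[of l k] l1 l2 2 by simp
qed

subsection \<open>Squares\<close>

text \<open>With \<open>s = Q k + l * Q (Suc k) \<le> n < s + Q (Suc k)\<close>, the sign of \<open>n\<alpha> - c\<close> decides whether \<open>n\<close> is
  a multiple of \<open>s\<close> (then \<open>n = s\<close>) or of \<open>Q (Suc k)\<close>.\<close>

lemma square_classification:
  assumes w: "length w = n" "n \<ge> 1" and L: "word_pow w 2 \<in> codes \<alpha>"
  obtains (semi) k l m where "1 \<le> l" "l < a (Suc k)" "n = Q k + l * Q (Suc k)" "m < n" "n < m + Q (Suc k)"
      "w = orbit_word (\<beta> (Suc k)) n m"
    | (conv) k e m where "1 \<le> e" "n = e * Q (Suc k)" "m < Q (Suc k)" "n < Q (Suc (Suc k))"
      "w = word_pow (orbit_word (\<beta> k) (Q (Suc k)) m) e"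
proof -
  \<comment> \<open>Shared end of the cases where \<open>n\<close> is a multiple of a convergent
    denominator: the square is refined to a \<open>2e\<close>-th power, whose root is an orbit
    word.\<close>
  have conv_case: thesis if P: "floor_period (\<beta> k) (e * Q (Suc k)) (int e * c k (Suc k)) y (e * Q (Suc k))"
    and wy: "code (\<beta> k) y n = w" and ne: "n = e * Q (Suc k)" for k y e
  proof -
    define s where "s = Q (Suc k)"
    have e: "e \<ge> 1" using ne w by (cases e) auto
    have U: "unimod (\<beta> k) s (c k (Suc k)) (Q (Suc (Suc k))) (c k (Suc (Suc k)))"
      using unimod_conv unfolding s_def .
    then have R: "floor_period (\<beta> k) s (c k (Suc k)) y ((2 * e - 1) * s)"
      using P e by (intro period_root) (auto simp: unimod_def s_def)
    have "s \<le> (2 * e - 1) * s" using e by (cases "2 * e - 1") auto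
    from unimod_period_orbit[OF U _ R this] less_conv[of k] obtain m where
      m: "m < s" "(2 * e - 1) * s < m + Q (Suc (Suc k))" "code (\<beta> k) y s = orbit_word (\<beta> k) s m"
      unfolding s_def by blast
    have "(e - 1) * s \<le> (2 * e - 1) * s" by (intro mult_le_mono) auto
    with floor_period_word_pow[OF floor_period_mono[OF R] e] m(3) wy
    have w_eq: "w = word_pow (orbit_word (\<beta> k) s m) e" unfolding ne s_def by simp
    \<comment> \<open>For \<open>e \<ge> 2\<close>, \<open>(2 * e - 1) * s\<close> exceeds
      \<open>e * s\<close> by at least \<open>s > m\<close>, so the bound on \<open>m\<close> yields
      the claim.\<close>
    have "e * s < Q (Suc (Suc k))"
    proof (cases "e = 1")
      case True
      then show ?thesis using cden_less[of "Suc k"] by (simp add: s_def)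
    next
      case False
      then obtain f where f: "e = Suc (Suc f)" using e by (metis One_nat_def not0_implies_Suc not_one_le_zero)
      have "(2 * e - 1) * s = e * s + (f + 1) * s" unfolding f by (simp add: algebra_simps)
      then show ?thesis using m(1,2) by simp
    qed
    then show thesis using conv[of e k m] e m w_eq ne unfolding s_def by simp
  qed
  obtain k l where kl: "1 \<le> l" "l \<le> a (Suc k)" "Q k + l * Q (Suc k) \<le> n" "n < Q k + Suc l * Q (Suc k)"
    using semi_bracket w by blast
  define s t where "s = Q k + l * Q (Suc k)" and "t = Q (Suc k)"
  have st: "t \<le> s" "s \<le> n" "n < s + t"
    using kl(3,4) mult_le_mono1[OF kl(1), of "Q (Suc k)"] unfolding s_def t_def mult_Suc nat_mult_1
    by linarith+
  define cs where "cs = c (Suc k) k + int l * c (Suc k) (Suc k)"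
  have U: "unimod (\<beta> (Suc k)) s cs t (c (Suc k) (Suc k))"
    unfolding s_def t_def cs_def by (rule unimod_semi[OF kl(2)])
  define C where "C j = (if \<beta> j \<ge> 0 then 1 else -1) * int (sum_list w)" for j
  have per: "\<exists>y. code (\<beta> j) y n = w \<and> floor_period (\<beta> j) n (C j) y n" for j
  proof -
    obtain y where y: "code (\<beta> j) y (2 * n) = word_pow w 2"
      using word_pow_in_codesD[of w 2 "\<beta> j"] L w codes_beta by auto
    show ?thesis using word_pow_floor_period[OF abs_beta y w(1)] unfolding C_def by auto
  qed
  have CS: "C (Suc k) = - C k"
    using alpha beta_cases[of k] by (auto simp: C_def beta_Suc)
  \<comment> \<open>Irrationality gives a nonzero error, and mirroring flips its sign, so in exactly
    one orientation \<open>n\<close> approximates from above.\<close>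
  have "real n * \<beta> k \<noteq> of_int (C k)"
    using rational_mult_int[OF beta_irrational[of k], of "int n" "C k"] w by auto
  then consider "of_int (C (Suc k)) < real n * \<beta> (Suc k)" | "of_int (C k) < real n * \<beta> k"
    unfolding CS beta_Suc by fastforce
  then show thesis
  proof cases
    case 1
    obtain y where y: "code (\<beta> (Suc k)) y n = w" "floor_period (\<beta> (Suc k)) n (C (Suc k)) y n"
      using per by blast
    obtain e where e: "n = e * s" "C (Suc k) = int e * cs"
      using period_multiple[OF U st(2) _ st(3) y(2) 1] st by auto
    \<comment> \<open>Since \<open>t \<le> s\<close>, the bracket gives
      \<open>n < s + t \<le> 2 * s\<close>.\<close>
    have "e = 1"
    proof (rule ccontr)
      assume "e \<noteq> 1"
      then have "e \<ge> 2" using e(1) w by (cases e) auto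
      then have "2 * s \<le> n" using e(1) by simp
      then show False using st by simp
    qed
    then have n: "n = s" and C: "C (Suc k) = cs" using e by auto
    show thesis
    proof (cases "l < a (Suc k)")
      case True
      obtain m where "m < s" "n < m + t" "code (\<beta> (Suc k)) y s = orbit_word (\<beta> (Suc k)) s m"
        using unimod_period_orbit[OF U _ y(2)[unfolded C n]] less_semi[OF True] n
        unfolding s_def t_def cs_def by (metis le_refl)
      then show thesis using semi[of l k m] kl True y(1) n unfolding s_def t_def by simp
    next
      case False
      \<comment> \<open>The last intermediate fraction is the convergent with denominator
        \<open>Q (Suc (Suc k))\<close>, taken once.\<close>
      then have "l = a (Suc k)" using kl by simp
      then have "s = 1 * Q (Suc (Suc k))" "cs = int 1 * c (Suc k) (Suc (Suc k))"
        by (simp_all add: s_def cs_def c_Suc_Suc cden.simps(3))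
      then show thesis using conv_case[of "Suc k" 1 y] y C n by simp
    qed
  next
    case 2
    obtain y where y: "code (\<beta> k) y n = w" "floor_period (\<beta> k) n (C k) y n"
      using per by blast
    \<comment> \<open>In the mirrored basis the roles of \<open>s\<close> and \<open>t\<close> are
      exchanged, so now \<open>n\<close> is a multiple of \<open>t\<close>.\<close>
    have U': "unimod (\<beta> k) t (c k (Suc k)) s (- cs)"
      using unimod_swap[OF U] by (simp add: beta_Suc c_Suc_left)
    obtain e where e: "n = e * t" "C k = int e * c k (Suc k)"
      using period_multiple[OF U' _ st(2) _ y(2) 2] st by (auto simp: add.commute)
    then show thesis using conv_case[of k e y] y unfolding t_def by simp
  qed
qed

subsection \<open>Standard words\<close>

text \<open>Standard and semistandard words are prefixes of the characteristic word, the word of the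
  point \<open>\<alpha>\<close>. That word has period \<open>Q (Suc (Suc j))\<close> long enough for
  another copy of \<open>std a (Suc j)\<close> to be put in front.\<close>

lemma std_semi_code:
  assumes "std a j = code \<alpha> \<alpha> (Q (Suc j))" "std a (Suc j) = code \<alpha> \<alpha> (Q (Suc (Suc j)))"
  shows "l \<le> a (Suc (Suc j)) \<Longrightarrow>
    word_pow (std a (Suc j)) l @ std a j = code \<alpha> \<alpha> (Q (Suc j) + l * Q (Suc (Suc j)))"
proof (induction l)
  case (Suc l)
  define b s N where "b = \<beta> (Suc j)" and "s = Q (Suc (Suc j))" and "N = Q (Suc j) + l * Q (Suc (Suc j))"
  have "Suc l * s \<le> a (Suc (Suc j)) * s" using Suc.prems by (intro mult_le_mono) auto
  moreover have "s \<ge> 2" unfolding s_def by (rule cden_ge_2) simp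
  \<comment> \<open>The gap of 2 comes from \<open>s \<ge> 2\<close>; the orbit starts at
    \<open>b\<close>, so the multiple \<open>Suc i\<close> with \<open>i \<le> N\<close> must stay
    below the partner denominator.\<close>
  ultimately have N: "N + 1 < Q (Suc (Suc (Suc j)))" by (simp add: N_def s_def cden.simps(3))
  have "code b (b + real s * b) N = code b b N"
  proof (rule code_cong)
    fix i assume "i \<le> N"
    then have "int (Suc i) < int (Q (Suc (Suc (Suc j))))" using N by simp
    from unimod_floor_add[OF unimod_conv[of "Suc j"] _ this]
    show "\<lfloor>b + real s * b + real i * b\<rfloor> = \<lfloor>b + real i * b\<rfloor> + c (Suc j) (Suc (Suc j))"
      by (simp add: b_def s_def algebra_simps)
  qed
  then have "code b b (s + N) = code b b s @ code b b N" by (simp add: code_append)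
  then have "code \<alpha> \<alpha> (s + N) = code \<alpha> \<alpha> s @ code \<alpha> \<alpha> N" unfolding b_def code_beta_self .
  then show ?case using Suc assms(2) by (simp add: s_def N_def add_ac)
qed (simp add: assms)

lemma std_code: "std a j = code \<alpha> \<alpha> (Q (Suc j)) \<and> std a (Suc j) = code \<alpha> \<alpha> (Q (Suc (Suc j)))"
proof (induction j)
  case 0
  \<comment> \<open>The inequalities \<open>0 < E 2 < E 1\<close> say that
    \<open>a 1 * \<alpha> < 1 < (a 1 + 1) * \<alpha>\<close>, which locates the first letter
    1.\<close>
  have a1\<alpha>: "real (a 1) * \<alpha> < 1" using cerr_pos_less[of 2] by (simp add: numeral_2_eq_2)
  have a1\<alpha>': "real (Suc (a 1)) * \<alpha> > 1" using cerr_pos_less[of 1] by (simp add: algebra_simps)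
  have "2 * \<alpha> \<le> real (a 1) * \<alpha>" using a1 alpha by (intro mult_right_mono) auto
  then have "2 * \<alpha> < 1" using a1\<alpha> by linarith
  then have z: "std a 0 = code \<alpha> \<alpha> (Q (Suc 0))"
    using alpha floor_unique[of 0 "2 * \<alpha>"] floor_unique[of 0 \<alpha>] by (simp add: code_def)
  have f0: "\<lfloor>\<alpha> + real i * \<alpha>\<rfloor> = 0" if "i < a 1" for i
  proof -
    have "real (Suc i) * \<alpha> \<le> real (a 1) * \<alpha>" using that alpha by (intro mult_right_mono) auto
    then show ?thesis using a1\<alpha> alpha by (simp add: floor_eq_iff algebra_simps)
  qed
  have f1: "\<lfloor>\<alpha> + real (a 1) * \<alpha>\<rfloor> = 1"
    using a1\<alpha> a1\<alpha>' alpha by (simp add: floor_eq_iff algebra_simps)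
  obtain r where r: "a 1 = Suc r" using a1 by (cases "a 1") auto
  have "code \<alpha> \<alpha> r = replicate r 0"
    by (rule nth_equalityI) (use f0 r in \<open>auto simp: nth_code simp del: of_nat_Suc\<close>)
  then have "code \<alpha> \<alpha> (a 1) = replicate r 0 @ [1]"
    using f0[of r] f1 unfolding r code_Suc by (simp del: of_nat_Suc)
  then show ?case using z r by (simp add: cden.simps(3))
next
  case (Suc j)
  then show ?case
    using std_semi_code[of j "a (Suc (Suc j))"] by (simp add: add.commute cden.simps(3))
qed

lemma semistd_code:
  assumes "l \<le> a (Suc (Suc j))"
  shows "word_pow (std a (Suc j)) l @ std a j = code \<alpha> \<alpha> (Q (Suc j) + l * Q (Suc (Suc j)))"
  using std_semi_code[of j l] std_code assms by blast

lemma rev_semi: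
  assumes "k \<ge> 1" "1 \<le> l" "l \<le> a (Suc k)"
  shows "rev (code \<alpha> \<alpha> (Q k + l * Q (Suc k)))
    = orbit_word (\<beta> (Suc k)) (Q k + l * Q (Suc k)) (Q k + l * Q (Suc k) - Q (Suc k) + 1)"
proof -
  have "1 * Q (Suc k) \<le> l * Q (Suc k)" using assms(2) by (rule mult_le_mono1)
  then have le: "Q (Suc k) \<le> Q k + l * Q (Suc k)" by linarith
  show ?thesis
    using rev_code_self[OF unimod_semi[OF assms(3)] beta_irrational _ le] cden_ge_2[of "Suc k"] assms(1)
    by (simp add: code_beta_self)
qed

text \<open>Computed directly: here the partner denominator is \<open>Q 1 = 1\<close>, outside the
  range of \<open>rev_code_self\<close>.\<close>

lemma rev_std_1: "rev (std a 1) = orbit_word (\<beta> 1) (a 1) 0"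
proof (rule nth_equalityI)
  have b: "\<beta> 1 = - \<alpha>" by (simp add: \<beta>_def)
  fix j assume "j < length (rev (std a 1))"
  then have j: "j < a 1" using a1 by simp
  have f: "\<lfloor>- (real i * \<alpha>)\<rfloor> = -1" if "0 < i" "i \<le> a 1" for i
  proof -
    have "real i * \<alpha> \<le> real (a 1) * \<alpha>" using that alpha by (intro mult_right_mono) auto
    moreover have "real (a 1) * \<alpha> < 1" using cerr_pos_less[of 2] by (simp add: numeral_2_eq_2)
    moreover have "real i * \<alpha> > 0" using that alpha by simp
    ultimately show ?thesis by (simp add: floor_eq_iff)
  qed
  have "orbit_word (\<beta> 1) (a 1) 0 ! j = (if j = 0 then 1 else 0)"
    using f[of j] f[of "Suc j"] j unfolding orbit_word_def nth_code[OF j] b by (auto simp del: of_nat_Suc)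
  moreover have "rev (std a 1) ! j = (if j = 0 then 1 else 0)"
    using j by (cases j) auto
  ultimately show "rev (std a 1) ! j = orbit_word (\<beta> 1) (a 1) 0 ! j" by simp
qed (use a1 in simp)

text \<open>The reversal lemma with partner \<open>Q k\<close> gives the starting point. The
  remainder also covers \<open>k = 1\<close>, where \<open>Q k = 1\<close> makes the starting index
  wrap to 0.\<close>

lemma cshift_rev_std:
  assumes "k \<ge> 1"
  shows "(cshift ^^ i) (rev (std a k))
    = orbit_word (\<beta> k) (Q (Suc k)) ((Q (Suc k) - Q k + 1 + i) mod Q (Suc k))"
proof -
  have pos: "Q (Suc k) > 0" "Q (Suc (Suc k)) > 0" using cden_pos[of k] cden_pos[of "Suc k"] by auto
  have "rev (std a k) = orbit_word (\<beta> k) (Q (Suc k)) ((Q (Suc k) - Q k + 1) mod Q (Suc k))"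
  proof (cases "k = 1")
    case True
    have "Q (Suc 1) = a 1" "Q 1 = 1" by (simp_all add: cden.simps(3))
    then show ?thesis unfolding True rev_std_1 using a1 by simp
  next
    case False
    then obtain j where k: "k = Suc j" and j: "j \<ge> 1" using assms by (cases k) auto
    have Qk: "Q (Suc k) = Q j + a k * Q k" by (simp add: k cden.simps(3))
    have "Q k \<ge> 2" "Q k \<le> Q (Suc k)" using cden_ge_2[of k] cden_less[of k] k j by auto
    then have "Q (Suc k) - Q k + 1 < Q (Suc k)" by simp
    moreover have "rev (std a k) = orbit_word (\<beta> k) (Q (Suc k)) (Q (Suc k) - Q k + 1)"
      using rev_semi[OF j, of "a k"] a_pos[of k] std_code[of k] Qk k by simp
    ultimately show ?thesis by simp
  qed
  then show ?thesis
    using funpow_cshift_orbit_word[OF unimod_conv[of k], of "(Q (Suc k) - Q k + 1) mod Q (Suc k)" i] pos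
    by (simp add: mod_add_left_eq)
qed

subsection \<open>Indices\<close>

text \<open>Without wrap-around of \<open>m\<close>, the bound \<open>m + Q (Suc (Suc k))\<close>
  equals \<open>(a (k + 1) + 1) * N + i + 1\<close>; after wrap-around one multiple of
  \<open>N\<close> is lost. Wrapping begins at \<open>i = Q k - 1\<close>.\<close>

lemma conj_pow_iff:
  assumes k: "k \<ge> 1" and i: "i < Q (Suc k)" and p: "p \<ge> 1"
  shows "word_pow ((cshift ^^ i) (rev (std a k))) p \<in> codes \<alpha>
    \<longleftrightarrow> p \<le> (if i < Q k - 1 then a (k + 1) + 2 else a (k + 1) + 1)"
proof -
  define N r m where "N = Q (Suc k)" and "r = Q k" and "m = (N - r + 1 + i) mod N"
  have r: "1 \<le> r" "r < N" using cden_pos[of "k - 1"] cden_less[of k] k by (auto simp: r_def N_def)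
  have Q2: "Q (Suc (Suc k)) = a (k + 1) * N + r" by (simp add: N_def r_def cden.simps(3))
  have iN: "i < N" using i by (simp add: N_def)
  have "m < N" using r by (simp add: m_def)
  then have "word_pow ((cshift ^^ i) (rev (std a k))) p \<in> codes \<alpha> \<longleftrightarrow> (p - 1) * N < m + (a (k + 1) * N + r)"
    using conv_pow_iff[of m k p] p unfolding cshift_rev_std[OF k] N_def[symmetric] r_def[symmetric] m_def[symmetric] Q2
    by simp
  also have "\<dots> \<longleftrightarrow> p \<le> (if i < r - 1 then a (k + 1) + 2 else a (k + 1) + 1)"
  proof (cases "i < r - 1")
    case True
    then have "N - r + 1 + i < N" using r by linarith
    then have "m = N - r + 1 + i" unfolding m_def by (rule mod_less)
    then have "m + (a (k + 1) * N + r) = (a (k + 1) + 1) * N + i + 1" using r by simp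
    then have "(p - 1) * N < m + (a (k + 1) * N + r) \<longleftrightarrow> (p - 1) * N \<le> (a (k + 1) + 1) * N + i"
      by linarith
    then show ?thesis unfolding mult_le_add_iff[OF iN] using True by auto
  next
    case False
    then have "N - r + 1 + i = N + (i + 1 - r)" "i + 1 - r < N" using r iN by linarith+
    then have "m = i + 1 - r" unfolding m_def by simp
    then have "m + (a (k + 1) * N + r) = a (k + 1) * N + i + 1" using r False by simp
    then have "(p - 1) * N < m + (a (k + 1) * N + r) \<longleftrightarrow> (p - 1) * N \<le> a (k + 1) * N + i"
      by linarith
    then show ?thesis unfolding mult_le_add_iff[OF iN] using False by auto
  qed
  finally show ?thesis unfolding r_def .
qed

lemma conj_index:
  assumes k: "k \<ge> 1" and i: "i < Q (Suc k)" and m: "m \<ge> 1"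
  shows "index (codes \<alpha>) ((cshift ^^ i) (word_pow (rev (std a k)) m))
    = enat ((if i < Q k - 1 then a (k + 1) + 2 else a (k + 1) + 1) div m)"
  unfolding funpow_cshift_word_pow by (rule index_word_powI[OF conj_pow_iff[OF k i] m])

lemma conj_set:
  assumes k: "k \<ge> 1"
  shows "{(cshift ^^ i) (rev (std a k)) | i. i < Q (Suc k)} = orbit_word (\<beta> k) (Q (Suc k)) ` {..<Q (Suc k)}"
proof -
  define N where "N = Q (Suc k)"
  define m0 where "m0 = N - Q k + 1"
  have N: "N > 0" using cden_pos[of k] by (simp add: N_def)
  have cs: "(cshift ^^ i) (rev (std a k)) = orbit_word (\<beta> k) N ((m0 + i) mod N)" for i
    using cshift_rev_std[OF k, of i] by (simp add: N_def m0_def)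
  have "\<exists>i<N. (m0 + i) mod N = m" if "m < N" for m
  proof -
    \<comment> \<open>Adding \<open>N - m0 mod N\<close> subtracts \<open>m0\<close> modulo
      \<open>N\<close> without truncation.\<close>
    define i where "i = (m + (N - m0 mod N)) mod N"
    have "m0 mod N < N" using N by simp
    then have e: "m0 + (m + (N - m0 mod N)) = m + N * (1 + m0 div N)"
      using mult_div_mod_eq[of N m0] unfolding distrib_left by linarith
    have "(m0 + i) mod N = (m0 + (m + (N - m0 mod N))) mod N" unfolding i_def by (rule mod_add_right_eq)
    also have "\<dots> = m" unfolding e using that by (simp del: mult_Suc_right)
    finally show ?thesis using N by (intro exI[of _ i]) (auto simp: i_def)
  qed
  moreover have "(m0 + i) mod N < N" for i using N by simp
  ultimately show ?thesis unfolding cs N_def[symmetric] by (auto simp: image_iff)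
qed

section \<open>Factors of a given length and their squares\<close>

lemma factors_len_codes: "factors_len (codes \<alpha>) n = orbit_word (\<beta> k) n ` {..n}"
proof (intro subset_antisym subsetI)
  fix w assume "w \<in> factors_len (codes \<alpha>) n"
  then obtain y where w: "w = code (\<beta> k) y n"
    unfolding factors_len_def codes_beta[of k, symmetric] by (auto simp: codes_def)
  obtain m where "m \<le> n" "w = orbit_word (\<beta> k) n m" unfolding w by (rule code_orbit_word)
  then show "w \<in> orbit_word (\<beta> k) n ` {..n}" by simp
next
  fix w assume "w \<in> orbit_word (\<beta> k) n ` {..n}"
  then show "w \<in> factors_len (codes \<alpha>) n"
    unfolding factors_len_def codes_beta[of k, symmetric] by auto
qed

lemma semi_less: "l < a (Suc k) \<Longrightarrow> Q k + l * Q (Suc k) + Q (Suc k) \<le> Q (Suc (Suc k))"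
  using mult_le_mono1[of "Suc l" "a (Suc k)" "Q (Suc k)"] by (simp add: cden.simps(3))

lemma semi_bounds:
  assumes "1 \<le> l" "l < a (Suc k)"
  shows "Q (Suc k) \<le> Q k + l * Q (Suc k)" "Q k + l * Q (Suc k) < Q (Suc (Suc k))"
  using semi_less[OF assms(2)] cden_pos[of k] mult_le_mono1[OF assms(1), of "Q (Suc k)"] by linarith+

lemma not_dvd_semi:
  assumes "k \<ge> 1"
  shows "\<not> Q (Suc k) dvd Q k + l * Q (Suc k)"
proof
  assume "Q (Suc k) dvd Q k + l * Q (Suc k)"
  then have "Q (Suc k) dvd Q k" by (simp add: dvd_add_left_iff)
  moreover have "0 < Q k" using cden_pos[of "k - 1"] assms by simp
  ultimately show False using cden_less[OF assms] dvd_imp_le by fastforce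
qed

text \<open>The bracket of convergent denominators containing \<open>n\<close> fixes the level in
  the classification; divisibility then rules out an intermediate denominator.\<close>

lemma conv_square:
  assumes w: "length w = n" and n: "Q (Suc k) dvd n" "Q (Suc k) \<le> n" "n < Q (Suc (Suc k))"
    and L: "word_pow w 2 \<in> codes \<alpha>"
  obtains m where "m < Q (Suc k)" "w = word_pow (orbit_word (\<beta> k) (Q (Suc k)) m) (n div Q (Suc k))"
proof -
  have n1: "n \<ge> 1" using n cden_pos[of k] by simp
  from w n1 L show thesis
  proof (cases rule: square_classification)
    case (semi j l m)
    have "Suc j = Suc k"
      using semi_bounds[OF semi(1,2)] n semi(3) by (intro cden_bracket_unique[of _ _ n]) auto
    \<comment> \<open>At level 0 the bounds would read
      \<open>m < n < m + Q 1 = m + 1\<close>.\<close>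
    moreover have "j \<noteq> 0"
    proof
      assume "j = 0"
      then show False using semi by simp
    qed
    ultimately show thesis using not_dvd_semi[of k l] n(1) semi(3) by simp
  next
    case (conv j e m)
    have "Suc j = Suc k"
      using conv n mult_le_mono1[OF conv(1), of "Q (Suc j)"] by (intro cden_bracket_unique[of _ _ n]) auto
    then show thesis using that[of m] conv cden_pos[of k] by simp
  qed
qed

lemma semi_square:
  assumes w: "length w = n" and k: "k \<ge> 1" and l: "1 \<le> l" "l < a (Suc k)" and n: "n = Q k + l * Q (Suc k)"
    and L: "word_pow w 2 \<in> codes \<alpha>"
  obtains m where "m < n" "n < m + Q (Suc k)" "w = orbit_word (\<beta> (Suc k)) n m"
proof -
  have nb: "Q (Suc k) \<le> n" "n < Q (Suc (Suc k))" unfolding n using semi_bounds[OF l] .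
  have n1: "n \<ge> 1" using nb cden_pos[of k] by simp
  from w n1 L show thesis
  proof (cases rule: square_classification)
    case (semi j l' m)
    have "Suc j = Suc k"
      using semi_bounds[OF semi(1,2)] nb semi(3) by (intro cden_bracket_unique[of _ _ n]) auto
    then show thesis using that[of m] semi by simp
  next
    case (conv j e m)
    have "Suc j = Suc k"
      using conv nb mult_le_mono1[OF conv(1), of "Q (Suc j)"] by (intro cden_bracket_unique[of _ _ n]) auto
    then show thesis using not_dvd_semi[OF k, of l] conv(2) n by (metis dvd_triv_right nat.inject)
  qed
qed

text \<open>The conjugates account for \<open>m < Q (Suc k)\<close>, leaving only
  \<open>m = Q (Suc k)\<close>. Every factor of this length with a square is an orbit word of the
  first kind.\<close>

lemma exceptional_word:
  assumes k: "k \<ge> 1"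
  defines "v \<equiv> orbit_word (\<beta> k) (Q (Suc k)) (Q (Suc k))"
  shows "factors_len (codes \<alpha>) (Q (Suc k)) - {(cshift ^^ i) (rev (std a k)) | i. i < Q (Suc k)} = {v}"
    and "index (codes \<alpha>) v = 1"
proof -
  define N where "N = Q (Suc k)"
  have v: "v = orbit_word (\<beta> k) N N" by (simp add: v_def N_def)
  have ne: "orbit_word (\<beta> k) N m \<noteq> v" if "m < N" for m
    using orbit_word_inj[OF beta_irrational[of k] abs_beta[of k], of m N N] that by (auto simp: v)
  have "orbit_word (\<beta> k) N ` {..N} - orbit_word (\<beta> k) N ` {..<N} = {v}"
  proof -
    have "v \<notin> orbit_word (\<beta> k) N ` {..<N}" using ne by blast
    moreover have "{..N} = insert N {..<N}" by auto
    ultimately show ?thesis unfolding v by auto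
  qed
  then show "factors_len (codes \<alpha>) (Q (Suc k)) - {(cshift ^^ i) (rev (std a k)) | i. i < Q (Suc k)} = {v}"
    unfolding conj_set[OF k] factors_len_codes[of _ k] N_def .
  show "index (codes \<alpha>) v = 1"
  proof (rule index_codes_1)
    show "v \<in> codes \<alpha>" unfolding codes_beta[of k, symmetric] v by simp
    show "word_pow v 2 \<notin> codes \<alpha>"
    proof
      assume "word_pow v 2 \<in> codes \<alpha>"
      then obtain m where "m < N" "v = word_pow (orbit_word (\<beta> k) N m) (N div N)"
        using conv_square[of v N k] cden_less[of "Suc k"] unfolding N_def v by auto
      then show False using ne[of m] by simp
    qed
  qed
qed

lemma index_rest:
  assumes "w \<in> factors_len (codes \<alpha>) n - S" and "length w = n \<Longrightarrow> word_pow w 2 \<in> codes \<alpha> \<Longrightarrow> w \<in> S"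
  shows "index (codes \<alpha>) w = 1"
  using assms by (intro index_codes_1) (auto simp: factors_len_def)

lemma conv_multiple_rest:
  assumes k: "k \<ge> 1" and m: "m \<ge> 1" "m \<le> a (k + 1)"
    and w: "w \<in> factors_len (codes \<alpha>) (m * Q (Suc k)) - {(cshift ^^ i) (word_pow (rev (std a k)) m) | i. i < Q (Suc k)}"
  shows "index (codes \<alpha>) w = 1"
proof (rule index_rest[OF w])
  define N where "N = Q (Suc k)"
  assume l: "length w = m * Q (Suc k)" and L: "word_pow w 2 \<in> codes \<alpha>"
  have "1 * N \<le> m * N" by (rule mult_le_mono1[OF m(1)])
  moreover have "m * N \<le> a (Suc k) * N" using m(2) by (intro mult_le_mono1) simp
  moreover have "Q k \<ge> 1" using cden_pos[of "k - 1"] k by simp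
  ultimately have b: "N \<le> m * N" "m * N < Q (Suc (Suc k))"
    unfolding N_def cden.simps(3) by linarith+
  obtain j where j: "j < N" "w = word_pow (orbit_word (\<beta> k) N j) (m * N div N)"
    using conv_square[OF l dvd_triv_right _ _ L] b unfolding N_def by blast
  have "orbit_word (\<beta> k) N j \<in> {(cshift ^^ i) (rev (std a k)) | i. i < N}"
    unfolding N_def conj_set[OF k] using j by (simp add: N_def)
  then show "w \<in> {(cshift ^^ i) (word_pow (rev (std a k)) m) | i. i < Q (Suc k)}"
    unfolding funpow_cshift_word_pow j N_def[symmetric] using j(1) by auto
qed

text \<open>This length is \<open>Q (Suc (Suc k))\<close> plus less than \<open>Q (Suc k)\<close>.
  It falls into the next bracket, below the first intermediate denominator and below twice
  \<open>Q (Suc (Suc k))\<close>, so no factor of this length has a square.\<close>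

lemma conv_multiple_large_rest:
  assumes k: "k \<ge> 1" and m: "m = a (k + 1) + 1" "m > 1"
    and w: "w \<in> factors_len (codes \<alpha>) (m * Q (Suc k))"
  shows "index (codes \<alpha>) w = 1"
proof (rule index_rest[of w _ "{}"])
  assume l: "length w = m * Q (Suc k)" and L: "word_pow w 2 \<in> codes \<alpha>"
  have n1: "m * Q (Suc k) \<ge> 1" using m(2) cden_pos[of k] by (simp add: Suc_le_eq)
  have mQ: "m * Q (Suc k) = Q (Suc (Suc k)) + (Q (Suc k) - Q k)"
    using cden_less[OF k] m by (simp add: cden.simps(3))
  have lt: "Q (Suc k) < Q (Suc (Suc k))" by (rule cden_less) simp
  have Qk: "1 \<le> Q k" "Q k < Q (Suc k)" using cden_pos[of "k - 1"] cden_less[OF k] k by simp_all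
  have mb: "Q (Suc (Suc k)) \<le> m * Q (Suc k)" "m * Q (Suc k) < Q (Suc (Suc (Suc k)))"
    "m * Q (Suc k) < Q (Suc (Suc k)) + Q (Suc k)"
    using mQ Qk mult_le_mono1[of 1 "a (Suc (Suc k))" "Q (Suc (Suc k))"] a_pos[of "Suc (Suc k)"]
    unfolding cden.simps(3)[of a "Suc k"] by linarith+
  from l n1 L show "w \<in> {}"
  proof (cases rule: square_classification)
    case (semi j l' r)
    have "Suc j = Suc (Suc k)"
      using semi_bounds[OF semi(1,2)] mb semi(3) by (intro cden_bracket_unique[of _ _ "m * Q (Suc k)"]) auto
    then show ?thesis using semi(3) mb(3) mult_le_mono1[OF semi(1), of "Q (Suc (Suc k))"] by simp
  next
    case (conv j e r)
    have "Suc j = Suc (Suc k)"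
      using conv mb mult_le_mono1[OF conv(1), of "Q (Suc j)"]
      by (intro cden_bracket_unique[of _ _ "m * Q (Suc k)"]) auto
    then have n: "m * Q (Suc k) = e * Q (Suc (Suc k))" using conv by simp
    have "e \<noteq> 1" using n mQ Qk by auto
    then have "2 * Q (Suc (Suc k)) \<le> e * Q (Suc (Suc k))" using conv(1) by (intro mult_le_mono1) simp
    then show ?thesis using n mb(3) lt by linarith
  qed
qed (use w in simp)

section \<open>Factors of length at most \<open>a 1\<close>\<close>

lemma factors_short:
  assumes n: "n \<ge> 1" "n \<le> a 1"
  shows "m \<le> n \<Longrightarrow> orbit_word \<alpha> n m
      = (if m = 0 then replicate n 0 else replicate (m - 1) 0 @ 1 # replicate (n - m) 0)"
    and "orbit_word (- \<alpha>) n n = replicate n 0"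
proof -
  have a1\<alpha>: "real (a 1) * \<alpha> < 1" using cerr_pos_less[of 2] by (simp add: numeral_2_eq_2)
  have f: "\<lfloor>real i * \<alpha>\<rfloor> = 0" "i > 0 \<Longrightarrow> \<lfloor>- (real i * \<alpha>)\<rfloor> = -1" if "i \<le> a 1" for i
  proof -
    have "real i * \<alpha> \<le> real (a 1) * \<alpha>" using that alpha by (intro mult_right_mono) auto
    then have 1: "real i * \<alpha> < 1" using a1\<alpha> by simp
    moreover have "real i * \<alpha> \<ge> 0" using alpha by simp
    ultimately show "\<lfloor>real i * \<alpha>\<rfloor> = 0" by (simp add: floor_eq_iff)
    assume "i > 0"
    then have "real i * \<alpha> > 0" using alpha by simp
    then show "\<lfloor>- (real i * \<alpha>)\<rfloor> = -1" using 1 by (simp add: floor_eq_iff)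
  qed
  \<comment> \<open>All multiples up to \<open>a 1 * \<alpha>\<close> stay below 1, so the orbit
    crosses an integer only on arriving at 0, at time \<open>m\<close>.\<close>
  have g: "\<lfloor>- (real m * \<alpha>) + real j * \<alpha>\<rfloor> = (if j < m then -1 else 0)" if "j \<le> n" "m \<le> n" for j m
  proof (cases "j < m")
    case True
    have "- (real m * \<alpha>) + real j * \<alpha> = - (real (m - j) * \<alpha>)"
      using True by (simp add: of_nat_diff algebra_simps)
    then show ?thesis using f(2)[of "m - j"] True that n by simp
  next
    case False
    have "- (real m * \<alpha>) + real j * \<alpha> = real (j - m) * \<alpha>"
      using False by (simp add: of_nat_diff algebra_simps)
    then show ?thesis using f(1)[of "j - m"] False that n by simp
  qed
  show "orbit_word \<alpha> n m = (if m = 0 then replicate n 0 else replicate (m - 1) 0 @ 1 # replicate (n - m) 0)"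
    if m: "m \<le> n"
  proof (rule nth_equalityI)
    fix j assume "j < length (orbit_word \<alpha> n m)"
    then have j: "j < n" by simp
    have "orbit_word \<alpha> n m ! j = (if Suc j = m then 1 else 0)"
      unfolding orbit_word_def nth_code[OF j] using g[of j m] g[of "Suc j" m] j m by auto
    then show "orbit_word \<alpha> n m ! j
        = (if m = 0 then replicate n 0 else replicate (m - 1) 0 @ 1 # replicate (n - m) 0) ! j"
      using j m by (auto simp: nth_append nth_Cons split: nat.splits)
  qed (use m n in auto)
  show "orbit_word (- \<alpha>) n n = replicate n 0"
  proof (rule nth_equalityI)
    fix j assume "j < length (orbit_word (- \<alpha>) n n)"
    then have j: "j < n" by simp
    have "- (real n * - \<alpha>) + real i * - \<alpha> = real (n - i) * \<alpha>" if "i \<le> n" for i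
      using that by (simp add: of_nat_diff algebra_simps)
    then have "\<lfloor>- (real n * - \<alpha>) + real i * - \<alpha>\<rfloor> = 0" if "i \<le> n" for i
      using that f(1)[of "n - i"] n by simp
    then have "orbit_word (- \<alpha>) n n ! j = 0"
      unfolding orbit_word_def nth_code[OF j] using j by (simp del: mult_minus_right of_nat_Suc)
    then show "orbit_word (- \<alpha>) n n ! j = replicate n 0 ! j" using j by simp
  qed simp
qed

lemma conjugates_unit:
  assumes "n \<ge> 1"
  shows "conjugates (replicate (n - 1) 0 @ [1]) = {replicate i 0 @ 1 # replicate (n - Suc i) 0 | i. i < n}"
proof -
  let ?w = "replicate (n - 1) 0 @ [1 :: nat]"
  \<comment> \<open>The first shift brings the letter 1 to the front, so position \<open>i\<close>
    is reached after \<open>i + 1\<close> shifts; the unshifted word has it at position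
    \<open>n - 1\<close>.\<close>
  have C: "(cshift ^^ Suc i) ?w = replicate i 0 @ 1 # replicate (n - Suc i) 0" if "i < n" for i
    using that
  proof (induction i)
    case (Suc i)
    have "n - Suc i = Suc (n - Suc (Suc i))" using Suc.prems by simp
    then have "replicate (n - Suc i) (0 :: nat) = replicate (n - Suc (Suc i)) 0 @ [0]"
      by (simp add: replicate_append_same)
    then have "(cshift ^^ Suc i) ?w = (replicate i 0 @ 1 # replicate (n - Suc (Suc i)) 0) @ [0]"
      using Suc by simp
    then show ?case by (metis append_Cons cshift_snoc funpow.simps(2) comp_apply replicate_Suc)
  qed simp
  have len: "length ?w = n" using assms by simp
  show ?thesis unfolding conjugates_def len
  proof (intro subset_antisym subsetI; clarify)
    fix i assume "i < n"
    then show "\<exists>j. (cshift ^^ i) ?w = replicate j 0 @ 1 # replicate (n - Suc j) 0 \<and> j < n"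
    proof (cases i)
      case 0
      then show ?thesis using assms by (intro exI[of _ "n - 1"]) auto
    next
      case (Suc j)
      then show ?thesis using C[of j] \<open>i < n\<close> by (intro exI[of _ j]) auto
    qed
  next
    fix i assume i: "i < n"
    show "\<exists>j. replicate i 0 @ 1 # replicate (n - Suc i) 0 = (cshift ^^ j) ?w \<and> j < n"
    proof (cases "Suc i = n")
      case True
      then show ?thesis using assms by (intro exI[of _ 0]) auto
    next
      case False
      then show ?thesis using C[OF i] i by (intro exI[of _ "Suc i"]) auto
    qed
  qed
qed

text \<open>Below \<open>a 1\<close> the governing convergent has denominator \<open>Q 1 = 1\<close>
  and orbit word \<open>[0]\<close>, so only powers of 0 have squares, and \<open>a 1\<close> is the
  longest run of zeros.\<close>

lemma short_factors:
  assumes n: "n \<ge> 1" "n < a 1"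
  defines "S \<equiv> conjugates (replicate (n - 1) 0 @ [1])"
  shows "factors_len (codes \<alpha>) n - S = {replicate n 0}"
    and "w \<in> S \<Longrightarrow> index (codes \<alpha>) w = 1"
    and "index (codes \<alpha>) (replicate n 0) = enat (a 1 div n)"
proof -
  have b0: "\<beta> 0 = \<alpha>" by (simp add: \<beta>_def)
  have Q1: "Q (Suc 0) = 1" "Q (Suc (Suc 0)) = a 1" by (simp_all add: cden.simps(3))
  note ow = factors_short(1)[OF n(1) less_imp_le[OF n(2)]]
  have F: "factors_len (codes \<alpha>) n = insert (replicate n 0) S"
  proof -
    have "{..n} = insert 0 (Suc ` {..<n})"
      by (simp add: atMost_Suc_eq_insert_0[symmetric] lessThan_Suc_atMost image_Suc_lessThan) auto
    then have "factors_len (codes \<alpha>) n = insert (orbit_word \<alpha> n 0) ((\<lambda>i. orbit_word \<alpha> n (Suc i)) ` {..<n})"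
      unfolding factors_len_codes[of n 0] b0 by (simp add: image_image)
    also have "orbit_word \<alpha> n 0 = replicate n 0" using ow[of 0] by simp
    also have "(\<lambda>i. orbit_word \<alpha> n (Suc i)) ` {..<n} = (\<lambda>i. replicate i 0 @ 1 # replicate (n - Suc i) 0) ` {..<n}"
      using ow by (intro image_cong) auto
    also have "\<dots> = S" unfolding S_def conjugates_unit[OF n(1)] by auto
    finally show ?thesis .
  qed
  have one: "1 \<in> set w" if "w \<in> S" for w
    using that unfolding S_def conjugates_unit[OF n(1)] by auto
  have "replicate n 0 \<notin> S" using one[of "replicate n 0"] by auto
  then show "factors_len (codes \<alpha>) n - S = {replicate n 0}" unfolding F by auto
  have o0: "orbit_word (\<beta> 0) (Q (Suc 0)) 0 = [0]"
    using factors_short(1)[of 1 0] a1 unfolding b0 Q1 by simp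
  have rep: "word_pow [0 :: nat] e = replicate e 0" for e by (induction e) auto
  show "index (codes \<alpha>) w = 1" if w: "w \<in> S"
  proof (rule index_codes_1)
    have wl: "w \<in> codes \<alpha>" "length w = n" using F w by (auto simp: factors_len_def)
    then show "w \<in> codes \<alpha>" by simp
    show "word_pow w 2 \<notin> codes \<alpha>"
    proof
      assume "word_pow w 2 \<in> codes \<alpha>"
      then obtain m where "m < Q (Suc 0)" "w = word_pow (orbit_word (\<beta> 0) (Q (Suc 0)) m) (n div Q (Suc 0))"
        using conv_square[of w n 0] wl n unfolding Q1 by auto
      then have "w = replicate n 0" using o0 unfolding Q1 by (simp add: rep)
      then show False using one[OF w] by auto
    qed
  qed
  have "word_pow [0] p \<in> codes \<alpha> \<longleftrightarrow> p \<le> a 1" if "p \<ge> 1" for p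
    using conv_pow_iff[of 0 0 p] that unfolding o0 unfolding Q1 by simp linarith
  from index_word_powI[OF this n(1)]
  show "index (codes \<alpha>) (replicate n 0) = enat (a 1 div n)" unfolding rep .
qed

section \<open>Semistandard words\<close>

lemma cshift_rev_semi:
  assumes k: "k \<ge> 1" and l: "1 \<le> l" "l < a (Suc k)" and i: "i < Q (Suc k) - 1"
  defines "n \<equiv> Q k + l * Q (Suc k)"
  shows "(cshift ^^ i) (rev (word_pow (std a k) l @ std a (k - 1)))
    = orbit_word (\<beta> (Suc k)) n (n - Q (Suc k) + 1 + i)"
proof -
  obtain j where kj: "k = Suc j" using k by (cases k) auto
  have b: "Q (Suc k) \<le> n" unfolding n_def using semi_bounds[OF l] by simp
  have pos: "Q (Suc k) > 0" using cden_pos[of k] by simp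
  have U: "unimod (\<beta> (Suc k)) n (c (Suc k) k + int l * c (Suc k) (Suc k)) (Q (Suc k)) (c (Suc k) (Suc k))"
    unfolding n_def using unimod_semi l by simp
  have n1: "n - Q (Suc k) + 1 < n" using cden_ge_2[of "Suc k"] k b by simp
  have "rev (word_pow (std a k) l @ std a (k - 1)) = orbit_word (\<beta> (Suc k)) n (n - Q (Suc k) + 1)"
    using semistd_code[of l j] rev_semi[OF k l(1)] l unfolding kj n_def by simp
  then show ?thesis
    using funpow_cshift_orbit_word[OF U n1 pos, of i] i b by simp
qed

text \<open>Here \<open>m + Q (Suc k) = n + 1 + i\<close>, so the power criterion becomes
  \<open>(p - 1) * n \<le> n + i\<close> with \<open>i < n\<close>.\<close>

lemma semi_index:
  assumes k: "k \<ge> 1" and l: "1 \<le> l" "l < a (Suc k)" and i: "i < Q (Suc k) - 1"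
  shows "index (codes \<alpha>) ((cshift ^^ i) (rev (word_pow (std a k) l @ std a (k - 1)))) = 2"
proof -
  define n where "n = Q k + l * Q (Suc k)"
  define m where "m = n - Q (Suc k) + 1 + i"
  have b: "Q (Suc k) \<le> n" unfolding n_def using semi_bounds[OF l] by simp
  have m: "m < n" "m + Q (Suc k) = n + 1 + i" using i b by (auto simp: m_def)
  have "(cshift ^^ i) (rev (word_pow (std a k) l @ std a (k - 1))) = orbit_word (\<beta> (Suc k)) n m"
    unfolding n_def m_def by (rule cshift_rev_semi[OF k l i])
  moreover have "index (codes \<alpha>) (orbit_word (\<beta> (Suc k)) n m) = enat 2"
  proof (rule index_eqI)
    fix p :: nat assume p: "p \<ge> 1"
    have "i < n" using i b by simp
    have "word_pow (orbit_word (\<beta> (Suc k)) n m) p \<in> codes \<alpha> \<longleftrightarrow> (p - 1) * n < m + Q (Suc k)"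
      using semi_pow_iff[OF l(2) _ p] m(1) unfolding n_def by simp
    also have "\<dots> \<longleftrightarrow> (p - 1) * n \<le> 1 * n + i" unfolding m(2) by linarith
    also have "\<dots> \<longleftrightarrow> p \<le> 2" unfolding mult_le_add_iff[OF \<open>i < n\<close>] by auto
    finally show "word_pow (orbit_word (\<beta> (Suc k)) n m) p \<in> codes \<alpha> \<longleftrightarrow> p \<le> 2" .
  qed
  ultimately show ?thesis by (simp add: numeral_eq_enat)
qed

lemma semi_rest:
  assumes k: "k \<ge> 1" and l: "1 \<le> l" "l < a (Suc k)"
    and w: "w \<in> factors_len (codes \<alpha>) (Q k + l * Q (Suc k)) -
      {(cshift ^^ i) (rev (word_pow (std a k) l @ std a (k - 1))) | i. i < Q (Suc k) - 1}"
  shows "index (codes \<alpha>) w = 1"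
proof (rule index_rest[OF w])
  define n where "n = Q k + l * Q (Suc k)"
  assume len: "length w = Q k + l * Q (Suc k)" and L: "word_pow w 2 \<in> codes \<alpha>"
  obtain m where m: "m < n" "n < m + Q (Suc k)" "w = orbit_word (\<beta> (Suc k)) n m"
    using semi_square[OF len k l refl L] unfolding n_def by blast
  have b: "Q (Suc k) \<le> n" unfolding n_def using semi_bounds[OF l] by simp
  \<comment> \<open>The square criterion \<open>n < m + Q (Suc k)\<close> with \<open>m < n\<close>
    is exactly the range of \<open>m\<close> reached by fewer than \<open>Q (Suc k) - 1\<close>
    shifts.\<close>
  define i where "i = m + Q (Suc k) - n - 1"
  have i: "i < Q (Suc k) - 1" "m = n - Q (Suc k) + 1 + i" using m b by (auto simp: i_def)
  have "(cshift ^^ i) (rev (word_pow (std a k) l @ std a (k - 1))) = orbit_word (\<beta> (Suc k)) n m"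
    unfolding i(2) unfolding n_def by (rule cshift_rev_semi[OF k l i(1)])
  then show "w \<in> {(cshift ^^ i) (rev (word_pow (std a k) l @ std a (k - 1))) | i. i < Q (Suc k) - 1}"
    using i(1) m(3) by (intro CollectI exI[of _ i]) (simp only:)
qed

text \<open>By the classification, a square would need a length \<open>e * Q (Suc k)\<close> with
  \<open>e > a (k + 1)\<close>. Such a length exceeds \<open>Q (Suc (Suc k))\<close>, contrary to
  the bound supplied with it.\<close>

lemma no_square:
  assumes n: "a 1 \<le> n" and not: "\<And>k. k \<ge> 1 \<Longrightarrow> n \<noteq> Q (Suc k)"
    "\<And>k l. k \<ge> 1 \<Longrightarrow> 1 \<le> l \<Longrightarrow> l < a (Suc k) \<Longrightarrow> n \<noteq> Q k + l * Q (Suc k)"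
    "\<And>k m. k \<ge> 1 \<Longrightarrow> 1 < m \<Longrightarrow> m \<le> a (k + 1) \<Longrightarrow> n \<noteq> m * Q (Suc k)"
    and w: "w \<in> factors_len (codes \<alpha>) n"
  shows "index (codes \<alpha>) w = 1"
proof (rule index_rest[of w _ "{}"])
  assume l: "length w = n" and L: "word_pow w 2 \<in> codes \<alpha>"
  have n1: "n \<ge> 1" using n a1 by simp
  have Q1: "Q (Suc 0) = 1" "Q (Suc (Suc 0)) = a 1" by (simp_all add: cden.simps(3))
  from l n1 L show "w \<in> {}"
  proof (cases rule: square_classification)
    case (semi k l m)
    have "k = 0" using not(2)[of k l] semi by (cases k) auto
    then show ?thesis using semi by simp
  next
    case (conv k e m)
    have k: "k \<ge> 1" using conv(4) n unfolding not_less_eq_eq[symmetric] by (cases k) (auto simp: Q1)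
    then have "e \<noteq> 1" using not(1)[OF k] conv(2) by auto
    then have "a (k + 1) < e" using not(3)[OF k, of e] conv(1,2) by fastforce
    then have "Suc (a (k + 1)) * Q (Suc k) \<le> e * Q (Suc k)" by (intro mult_le_mono1) simp
    then show ?thesis using conv(2,4) cden_less[OF k] by (simp add: cden.simps(3))
  qed
qed (use w in simp)

end

section \<open>Assembly of the length cases\<close>

theorem theorem4p5:
  fixes \<alpha> x :: real and a :: "nat \<Rightarrow> nat" and n :: nat and L :: "nat list set"
  assumes "0 < \<alpha>" and "\<alpha> < 1" and "\<alpha> \<notin> \<rat>"
    and "has_cfrac \<alpha> a" and "a 1 \<ge> 2"
    and "0 \<le> x" and "x < 1"
    and "L = factors (rot_word x \<alpha>)"
    and "n > 0"
  shows "
    (n < q a 1 \<longrightarrow>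
       (\<forall>w \<in> conjugates (replicate (n - 1) 0 @ [1]). index L w = 1) \<and>
       factors_len L n - conjugates (replicate (n - 1) 0 @ [1]) = {replicate n 0} \<and>
       index L (replicate n 0) = enat (a 1 div n))
  \<and> (n = q a 1 \<longrightarrow>
       (\<forall>w \<in> conjugates (rev (std a 1)). index L w = enat (a 2 + 1)) \<and>
       factors_len L n - conjugates (rev (std a 1)) = {replicate (a 1) 0} \<and>
       index L (replicate (a 1) 0) = 1)
  \<and> (\<forall>k\<ge>2. n = q a k \<longrightarrow>
       (\<forall>i. i < q a (k - 1) - 1 \<longrightarrow>
          index L ((cshift ^^ i) (rev (std a k))) = enat (a (k + 1) + 2)) \<and>
       (\<forall>i. q a (k - 1) - 1 \<le> i \<and> i < n \<longrightarrow>
          index L ((cshift ^^ i) (rev (std a k))) = enat (a (k + 1) + 1)) \<and>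
       (\<exists>v. factors_len L n - {(cshift ^^ i) (rev (std a k)) | i. i < n} = {v} \<and>
            index L v = 1))
  \<and> (\<forall>k\<ge>2. \<forall>l. 0 < l \<and> l < a k \<and> n = q_semi a k l \<longrightarrow>
       (\<forall>i. i < q a (k - 1) - 1 \<longrightarrow>
          index L ((cshift ^^ i) (rev (semistd a k l))) = 2) \<and>
       (\<forall>w \<in> factors_len L n -
              {(cshift ^^ i) (rev (semistd a k l)) | i. i < q a (k - 1) - 1}.
          index L w = 1))
  \<and> (\<forall>m. 1 < m \<and> m < a 2 + 1 \<and> n = m * q a 1 \<longrightarrow>
       (\<forall>i. i < q a 1 \<longrightarrow>
          index L ((cshift ^^ i) (word_pow (rev (std a 1)) m)) = enat ((a 2 + 1) div m)) \<and>
       (\<forall>w \<in> factors_len L n -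
              {(cshift ^^ i) (word_pow (rev (std a 1)) m) | i. i < q a 1}.
          index L w = 1))
  \<and> (\<forall>k\<ge>2. \<forall>m. 1 < m \<and> m < a (k + 1) + 2 \<and> n = m * q a k \<longrightarrow>
       (\<forall>i. i < q a (k - 1) - 1 \<longrightarrow>
          index L ((cshift ^^ i) (word_pow (rev (std a k)) m)) =
            enat ((a (k + 1) + 2) div m)) \<and>
       (\<forall>i. q a (k - 1) - 1 \<le> i \<and> i < q a k \<longrightarrow>
          index L ((cshift ^^ i) (word_pow (rev (std a k)) m)) =
            enat ((a (k + 1) + 1) div m)) \<and>
       (\<forall>w \<in> factors_len L n -
              {(cshift ^^ i) (word_pow (rev (std a k)) m) | i. i < q a k}.
          index L w = 1))
  \<and> (\<not> (n < q a 1 \<or> n = q a 1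
         \<or> (\<exists>k\<ge>2. n = q a k)
         \<or> (\<exists>k\<ge>2. \<exists>l. 0 < l \<and> l < a k \<and> n = q_semi a k l)
         \<or> (\<exists>m. 1 < m \<and> m < a 2 + 1 \<and> n = m * q a 1)
         \<or> (\<exists>k\<ge>2. \<exists>m. 1 < m \<and> m < a (k + 1) + 2 \<and> n = m * q a k)) \<longrightarrow>
       (\<forall>w \<in> factors_len L n. index L w = 1))"
proof -
  interpret cf_expansion \<alpha> a using assms by unfold_locales
  have L: "L = codes \<alpha>" using assms by (simp add: factors_rot_word)
  have q0: "q a 0 = 1" and q1: "q a 1 = a 1" by simp_all
  \<comment> \<open>Translates between indexings: level \<open>k\<close> of the semistandard words
    corresponds to \<open>j = k - 1\<close> in the expansion.\<close>
  have semi: "\<exists>j\<ge>1. k = Suc j \<and> semistd a k l = word_pow (std a j) l @ std a (j - 1)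
      \<and> q_semi a k l = Q j + l * Q (Suc j) \<and> q a (k - 1) = Q (Suc j)" if "k \<ge> 2" for k l
  proof -
    obtain i where "k = Suc (Suc i)" using \<open>k \<ge> 2\<close> by (metis Suc_le_D numeral_2_eq_2 Suc_le_mono)
    then show ?thesis by (auto simp: semistd_def q_semi_def cden_Suc)
  qed
  have conv: "k \<ge> 1" "q a k = Q (Suc k)" "q a (k - 1) = Q k" if "k \<ge> 2" for k
    using that by (auto simp: cden_Suc[symmetric])
  have Q12: "Q 1 = 1" "Q (Suc 1) = a 1" by (simp_all add: cden.simps(3))
  have conj1: "conjugates (rev (std a 1)) = {(cshift ^^ i) (rev (std a 1)) | i. i < Q (Suc 1)}"
    using a1 unfolding conjugates_def Q12 by simp
  show ?thesis unfolding L
  proof (intro conjI, goal_cases)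
    case 1
    show ?case using short_factors[of n] \<open>n > 0\<close> by (simp add: Suc_le_eq)
  next
    case 2
    have "index (codes \<alpha>) w = enat (a 2 + 1)" if "w \<in> conjugates (rev (std a 1))" for w
    proof -
      from that obtain i where "w = (cshift ^^ i) (rev (std a 1))" "i < Q (Suc 1)"
        unfolding conj1 by (elim CollectE exE conjE)
      then show ?thesis using conj_index[of 1 i 1] by (simp add: numeral_2_eq_2)
    qed
    \<comment> \<open>At level 1 the exceptional factor is the run of zeros, computed in the
      mirrored orientation because \<open>\<beta> 1 = -\<alpha>\<close>.\<close>
    moreover have "orbit_word (\<beta> 1) (Q (Suc 1)) (Q (Suc 1)) = replicate (a 1) 0"
      using factors_short(2)[of "a 1"] a1 unfolding Q12 by (simp add: \<beta>_def)
    ultimately show ?case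
      using exceptional_word[of 1] unfolding conj1 q1 Q12 by simp
  next
    case 3
    show ?case
    proof (intro allI impI)
      fix k assume k: "2 \<le> k" and n: "n = q a k"
      note ex = exceptional_word[OF conv(1)[OF k]]
      show "(\<forall>i. i < q a (k - 1) - 1 \<longrightarrow>
          index (codes \<alpha>) ((cshift ^^ i) (rev (std a k))) = enat (a (k + 1) + 2)) \<and>
       (\<forall>i. q a (k - 1) - 1 \<le> i \<and> i < n \<longrightarrow>
          index (codes \<alpha>) ((cshift ^^ i) (rev (std a k))) = enat (a (k + 1) + 1)) \<and>
       (\<exists>v. factors_len (codes \<alpha>) n - {(cshift ^^ i) (rev (std a k)) | i. i < n} = {v} \<and>
            index (codes \<alpha>) v = 1)"
        unfolding n conv(2,3)[OF k]
        using ex conj_index[OF conv(1)[OF k], of _ 1] cden_less[OF conv(1)[OF k]] by auto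
    qed
  next
    case 4
    show ?case
    proof (intro allI impI; elim conjE)
      fix k l assume k: "2 \<le> k" and l: "0 < l" "l < a k" and n: "n = q_semi a k l"
      obtain j where j: "j \<ge> 1" "k = Suc j" and s: "semistd a k l = word_pow (std a j) l @ std a (j - 1)"
        "q_semi a k l = Q j + l * Q (Suc j)" "q a (k - 1) = Q (Suc j)"
        using semi[OF k] by blast
      show "(\<forall>i. i < q a (k - 1) - 1 \<longrightarrow>
          index (codes \<alpha>) ((cshift ^^ i) (rev (semistd a k l))) = 2) \<and>
       (\<forall>w \<in> factors_len (codes \<alpha>) n -
              {(cshift ^^ i) (rev (semistd a k l)) | i. i < q a (k - 1) - 1}.
          index (codes \<alpha>) w = 1)"
        unfolding n s using semi_index[OF j(1), of l] semi_rest[OF j(1), of l] l j(2) by (simp add: Suc_le_eq)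
    qed
  next
    case 5
    show ?case
    proof (intro allI impI; elim conjE)
      fix m assume m: "1 < m" "m < a 2 + 1" and n: "n = m * q a 1"
      have q1': "q a 1 = Q (Suc 1)" by (rule cden_Suc[symmetric])
      show "(\<forall>i. i < q a 1 \<longrightarrow>
          index (codes \<alpha>) ((cshift ^^ i) (word_pow (rev (std a 1)) m)) = enat ((a 2 + 1) div m)) \<and>
       (\<forall>w \<in> factors_len (codes \<alpha>) n -
              {(cshift ^^ i) (word_pow (rev (std a 1)) m) | i. i < q a 1}.
          index (codes \<alpha>) w = 1)"
        unfolding n q1'
        using conj_index[of 1 _ m] conv_multiple_rest[of 1 m] m by (simp add: numeral_2_eq_2)
    qed
  next
    case 6
    show ?case
    proof (intro allI impI; elim conjE)
      fix k m assume k: "2 \<le> k" and m: "1 < m" "m < a (k + 1) + 2" and n: "n = m * q a k"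
      have "index (codes \<alpha>) w = 1"
        if "w \<in> factors_len (codes \<alpha>) (m * Q (Suc k)) -
              {(cshift ^^ i) (word_pow (rev (std a k)) m) | i. i < Q (Suc k)}" for w
      \<comment> \<open>The boundary value \<open>m = a (k + 1) + 1\<close> makes the length exceed
        \<open>Q (Suc (Suc k))\<close> and needs the next bracket.\<close>
      proof (cases "m \<le> a (k + 1)")
        case True
        then show ?thesis using conv_multiple_rest[OF conv(1)[OF k] _ _ that] m by simp
      next
        case False
        then have "m = a (k + 1) + 1" using m by linarith
        from conv_multiple_large_rest[OF conv(1)[OF k] this m(1) DiffD1[OF that]] show ?thesis .
      qed
      then show "(\<forall>i. i < q a (k - 1) - 1 \<longrightarrow>
          index (codes \<alpha>) ((cshift ^^ i) (word_pow (rev (std a k)) m)) =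
            enat ((a (k + 1) + 2) div m)) \<and>
       (\<forall>i. q a (k - 1) - 1 \<le> i \<and> i < q a k \<longrightarrow>
          index (codes \<alpha>) ((cshift ^^ i) (word_pow (rev (std a k)) m)) =
            enat ((a (k + 1) + 1) div m)) \<and>
       (\<forall>w \<in> factors_len (codes \<alpha>) n -
              {(cshift ^^ i) (word_pow (rev (std a k)) m) | i. i < q a k}.
          index (codes \<alpha>) w = 1)"
        unfolding n conv(2,3)[OF k]
        using conj_index[OF conv(1)[OF k], of _ m] cden_less[OF conv(1)[OF k]] m by auto
    qed
  next
    case 7
    show ?case
    proof (intro impI ballI)
      fix w
      assume not: "\<not> (n < q a 1 \<or> n = q a 1
         \<or> (\<exists>k\<ge>2. n = q a k)
         \<or> (\<exists>k\<ge>2. \<exists>l. 0 < l \<and> l < a k \<and> n = q_semi a k l)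
         \<or> (\<exists>m. 1 < m \<and> m < a 2 + 1 \<and> n = m * q a 1)
         \<or> (\<exists>k\<ge>2. \<exists>m. 1 < m \<and> m < a (k + 1) + 2 \<and> n = m * q a k))"
        and w: "w \<in> factors_len (codes \<alpha>) n"
      \<comment> \<open>The case list treats level 1 separately, whereas \<open>no_square\<close>
        runs over all levels from 1 on.\<close>
      have one: "k = 1 \<or> k \<ge> 2" if "k \<ge> 1" for k :: nat using that by linarith
      have "n \<noteq> Q (Suc k)" if "k \<ge> 1" for k
        using not one[OF that] unfolding cden_Suc[symmetric] by blast
      moreover have "n \<noteq> m * Q (Suc k)" if "k \<ge> 1" "1 < m" "m \<le> a (k + 1)" for k m
        using not one[OF that(1)] that(2,3) unfolding cden_Suc[symmetric]
        by (metis Suc_eq_plus1 Suc_1 le_imp_less_Suc less_SucI add_2_eq_Suc')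
      moreover have "n \<noteq> Q k + l * Q (Suc k)" if "k \<ge> 1" "1 \<le> l" "l < a (Suc k)" for k l
      proof -
        have "2 \<le> Suc k" using that by simp
        moreover from semi[OF this, of l] have "q_semi a (Suc k) l = Q k + l * Q (Suc k)" by auto
        ultimately show ?thesis using not that by (metis Suc_le_lessD One_nat_def)
      qed
      moreover have "a 1 \<le> n" using not unfolding q1 by simp
      ultimately show "index (codes \<alpha>) w = 1" using no_square[OF _ _ _ _ w] by blast
    qed
  qed
qed

end
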